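(* Let $k$ be an algebraically closed field, let $n\ge 2$, and let $Q_1,\dots,Q_n$ be finite, connected, acyclic quivers. The category $Rep_{(Q_1,\dots,Q_n)}$ of $n$-representations is cocomplete, and the forgetful functor $\mathcal{U}_n:Rep_{(Q_1,\dots,Q_n)}\to Rep_k(Q_1)\times\cdots\times Rep_k(Q_n)$, $(V^{(1)},\dots,V^{(n)},\psi_1,\dots,\psi_{n-1})\mapsto (V^{(1)},\dots,V^{(n)})$, is cocontinuous (preserves all small colimits). Furthermore, colimits in $Rep_{(Q_1,\dots,Q_n)}$ can be obtained by the corresponding construction in $Rep_k(Q_1)\times\cdots\times Rep_k(Q_n)$: if $\mathscr{D}$ is a small category, $\mathscr{F}:\mathscr{D}\to Rep_{(Q_1,\dots,Q_n)}$ is a functor, and for each $m$ the pair $(C^{(m)},(\zeta^{(m),D})_{D\in\mathscr{D}})$ is a colimit of the composite of $\mathcal{U}_n\mathscr{F}$ with the projection to $Rep_k(Q_m)$, then there are families $\psi'_1,\dots,\psi'_{n-1}$ of $k$-linear maps such that $(C^{(1)},\dots,C^{(n)},\psi'_1,\dots,\psi'_{n-1})$ is an $n$-representation which, together with the morphisms $(\zeta^{(1),D},\dots,\zeta^{(n),D})_{D\in\mathscr{D}}$, is a colimit of $\mathscr{F}$.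
   Context: A quiver has a vertex set, an arrow set, and source and target maps $s,t$ from arrows to vertices. $Rep_k(Q)$ is the category of $k$-linear representations $M=(M_i,\varphi_\alpha)$ of $Q$ ($k$-vector spaces $M_i$ for vertices $i$, $k$-linear maps $\varphi_\alpha:M_{s(\alpha)}\to M_{t(\alpha)}$ for arrows $\alpha$, not necessarily finite dimensional); morphisms are families of linear maps $f_i$ commuting with the structure maps. An $n$-representation of $(Q_1,\dots,Q_n)$ is a $(2n-1)$-tuple $(V^{(1)},\dots,V^{(n)},\psi_1,\dots,\psi_{n-1})$ where $V^{(m)}\in Rep_k(Q_m)$ and, for $1\le m\le n-1$, $\psi_m$ is a family of $k$-linear maps $(\psi_m)_{\gamma}^{\delta}:V^{(m)}_{t(\gamma)}\to V^{(m+1)}_{s(\delta)}$, one for each pair ($\gamma$ an arrow of $Q_m$, $\delta$ an arrow of $Q_{m+1}$), with no further condition. A morphism to $(W^{(1)},\dots,W^{(n)},\theta_1,\dots,\theta_{n-1})$ is an $n$-tuple $(f^{(1)},\dots,f^{(n)})$ of morphisms $f^{(m)}:V^{(m)}\to W^{(m)}$ in $Rep_k(Q_m)$ with $f^{(m+1)}_{s(\delta)}(\psi_m)_\gamma^\delta=(\theta_m)_\gamma^\delta f^{(m)}_{t(\gamma)}$ for all such $m,\gamma,\delta$. Composition is componentwise. *)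

theory Defs
  imports
    "HOL-Algebra.Algebraic_Closure"
    "Graph_Theory.Digraph_Component"
begin

unbundle cardinal_syntax

section \<open>Universes\<close>

text \<open>
  The elements of the type \<open>'u\<close> play the role of the elements of a universe: a set is small if
  it has fewer elements than \<open>'u\<close>. The only closure properties required are that \<open>\<nat>\<close> is
  small and that a small union of small sets is small (regularity). Both hold for every Grothendieck
  universe with an infinite element, and for every type of uncountable regular cardinality.
\<close>

definition small :: "'u itself \<Rightarrow> 'x set \<Rightarrow> bool" where
  "small _ A \<longleftrightarrow> |A| <o |UNIV :: 'u set|"

definition universe :: "'u itself \<Rightarrow> bool" where
  "universe U \<longleftrightarrow> small U (UNIV :: nat set) \<and> regularCard |UNIV :: 'u set|"


section \<open>Categories, functors and colimits\<close>

text \<open>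
  Hom-sets belonging to different pairs of objects need not be disjoint, so composition and the
  action of a functor on morphisms take the objects as arguments:
  \<open>Comp C a b c g f\<close> is the composite of \<open>f \<in> Hom C a b\<close> and \<open>g \<in> Hom C b c\<close>.
\<close>

record ('o, 'm) cat =
  Obj :: "'o set"
  Hom :: "'o \<Rightarrow> 'o \<Rightarrow> 'm set"
  Ident :: "'o \<Rightarrow> 'm"
  Comp :: "'o \<Rightarrow> 'o \<Rightarrow> 'o \<Rightarrow> 'm \<Rightarrow> 'm \<Rightarrow> 'm"

definition is_category :: "('o, 'm) cat \<Rightarrow> bool" where
  "is_category C \<longleftrightarrow>
     (\<forall>a\<in>Obj C. Ident C a \<in> Hom C a a) \<and>
     (\<forall>a\<in>Obj C. \<forall>b\<in>Obj C. \<forall>c\<in>Obj C. \<forall>f\<in>Hom C a b. \<forall>g\<in>Hom C b c.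
        Comp C a b c g f \<in> Hom C a c) \<and>
     (\<forall>a\<in>Obj C. \<forall>b\<in>Obj C. \<forall>f\<in>Hom C a b.
        Comp C a a b f (Ident C a) = f \<and> Comp C a b b (Ident C b) f = f) \<and>
     (\<forall>a\<in>Obj C. \<forall>b\<in>Obj C. \<forall>c\<in>Obj C. \<forall>d\<in>Obj C.
        \<forall>f\<in>Hom C a b. \<forall>g\<in>Hom C b c. \<forall>h\<in>Hom C c d.
        Comp C a c d h (Comp C a b c g f) = Comp C a b d (Comp C b c d h g) f)"

record ('o, 'm, 'p, 'q) fct =
  omap :: "'o \<Rightarrow> 'p"
  mmap :: "'o \<Rightarrow> 'o \<Rightarrow> 'm \<Rightarrow> 'q"

definition is_functor :: "('o, 'm) cat \<Rightarrow> ('p, 'q) cat \<Rightarrow> ('o, 'm, 'p, 'q) fct \<Rightarrow> bool" where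
  "is_functor C D F \<longleftrightarrow> is_category C \<and> is_category D \<and>
     (\<forall>a\<in>Obj C. omap F a \<in> Obj D) \<and>
     (\<forall>a\<in>Obj C. \<forall>b\<in>Obj C. \<forall>f\<in>Hom C a b. mmap F a b f \<in> Hom D (omap F a) (omap F b)) \<and>
     (\<forall>a\<in>Obj C. mmap F a a (Ident C a) = Ident D (omap F a)) \<and>
     (\<forall>a\<in>Obj C. \<forall>b\<in>Obj C. \<forall>c\<in>Obj C. \<forall>f\<in>Hom C a b. \<forall>g\<in>Hom C b c.
        mmap F a c (Comp C a b c g f) =
        Comp D (omap F a) (omap F b) (omap F c) (mmap F b c g) (mmap F a b f))"

definition fct_comp ::
  "('p, 'q, 'r, 's) fct \<Rightarrow> ('o, 'm, 'p, 'q) fct \<Rightarrow> ('o, 'm, 'r, 's) fct" where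
  "fct_comp G F =
     \<lparr> omap = (\<lambda>a. omap G (omap F a)),
       mmap = (\<lambda>a b f. mmap G (omap F a) (omap F b) (mmap F a b f)) \<rparr>"

definition is_cocone ::
  "('d, 'e) cat \<Rightarrow> ('o, 'm) cat \<Rightarrow> ('d, 'e, 'o, 'm) fct \<Rightarrow> 'o \<Rightarrow> ('d \<Rightarrow> 'm) \<Rightarrow> bool" where
  "is_cocone D C F L \<zeta> \<longleftrightarrow> L \<in> Obj C \<and>
     (\<forall>a\<in>Obj D. \<zeta> a \<in> Hom C (omap F a) L) \<and>
     (\<forall>a\<in>Obj D. \<forall>b\<in>Obj D. \<forall>f\<in>Hom D a b.
        Comp C (omap F a) (omap F b) L (\<zeta> b) (mmap F a b f) = \<zeta> a)"

definition is_colimit ::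
  "('d, 'e) cat \<Rightarrow> ('o, 'm) cat \<Rightarrow> ('d, 'e, 'o, 'm) fct \<Rightarrow> 'o \<Rightarrow> ('d \<Rightarrow> 'm) \<Rightarrow> bool" where
  "is_colimit D C F L \<zeta> \<longleftrightarrow> is_cocone D C F L \<zeta> \<and>
     (\<forall>L' \<zeta>'. is_cocone D C F L' \<zeta>' \<longrightarrow>
        (\<exists>!u. u \<in> Hom C L L' \<and> (\<forall>a\<in>Obj D. Comp C (omap F a) L L' u (\<zeta> a) = \<zeta>' a)))"

text \<open>
  The objects and morphisms of a small category are taken from \<open>'u\<close>, as for a category internal to
  a universe. Any category whose sets of objects and of morphisms are small is isomorphic to one of
  this kind.
\<close>

definition small_category :: "('u, 'u) cat \<Rightarrow> bool" where
  "small_category D \<longleftrightarrow> is_category D \<and> small TYPE('u) (Obj D) \<and>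
     (\<forall>a\<in>Obj D. \<forall>b\<in>Obj D. small TYPE('u) (Hom D a b))"

definition cocomplete :: "'u itself \<Rightarrow> ('o, 'm) cat \<Rightarrow> bool" where
  "cocomplete _ C \<longleftrightarrow> is_category C \<and>
     (\<forall>(D :: ('u, 'u) cat) F. small_category D \<and> is_functor D C F \<longrightarrow>
        (\<exists>L \<zeta>. is_colimit D C F L \<zeta>))"

definition cocontinuous ::
  "'u itself \<Rightarrow> ('o, 'm) cat \<Rightarrow> ('p, 'q) cat \<Rightarrow> ('o, 'm, 'p, 'q) fct \<Rightarrow> bool" where
  "cocontinuous _ C C' G \<longleftrightarrow> is_functor C C' G \<and>
     (\<forall>(D :: ('u, 'u) cat) F L \<zeta>.
        small_category D \<and> is_functor D C F \<and> is_colimit D C F L \<zeta> \<longrightarrow>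
        is_colimit D C' (fct_comp G F) (omap G L) (\<lambda>a. mmap G (omap F a) L (\<zeta> a)))"

definition prod_cat :: "'i set \<Rightarrow> ('i \<Rightarrow> ('o, 'm) cat) \<Rightarrow> ('i \<Rightarrow> 'o, 'i \<Rightarrow> 'm) cat" where
  "prod_cat I C =
     \<lparr> Obj = (\<Pi>\<^sub>E i\<in>I. Obj (C i)),
       Hom = (\<lambda>a b. \<Pi>\<^sub>E i\<in>I. Hom (C i) (a i) (b i)),
       Ident = (\<lambda>a. \<lambda>i\<in>I. Ident (C i) (a i)),
       Comp = (\<lambda>a b c g f. \<lambda>i\<in>I. Comp (C i) (a i) (b i) (c i) (g i) (f i)) \<rparr>"

definition proj_fct :: "'i \<Rightarrow> ('i \<Rightarrow> 'o, 'i \<Rightarrow> 'm, 'o, 'm) fct" where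
  "proj_fct i = \<lparr> omap = (\<lambda>a. a i), mmap = (\<lambda>a b f. f i) \<rparr>"


section \<open>Quivers and their representations\<close>

text \<open>
  A quiver is a directed multigraph in the sense of \<open>wf_digraph\<close>: \<open>tail\<close> and \<open>head\<close> are the
  source and target maps. \<open>connected\<close> is connectedness (with at least one vertex) of the
  underlying undirected graph, whereas \<open>cycle\<close> refers to oriented cycles, loops included.
\<close>

definition finite_connected_acyclic_quiver :: "('v, 'a) pre_digraph \<Rightarrow> bool" where
  "finite_connected_acyclic_quiver Q \<longleftrightarrow>
     fin_digraph Q \<and> Digraph_Component.connected Q \<and> \<not> (\<exists>p. pre_digraph.cycle Q p)"

text \<open>
  All maps and families below are extensional (\<open>undefined\<close> off their domain), so that equality in
  HOL is equality of maps and families on their domains.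
\<close>

definition lin_maps ::
  "('k, 'r) ring_scheme \<Rightarrow> ('k, 'u) module \<Rightarrow> ('k, 'u) module \<Rightarrow> ('u \<Rightarrow> 'u) set" where
  "lin_maps k M N = {f \<in> carrier M \<rightarrow>\<^sub>E carrier N.
     (\<forall>x\<in>carrier M. \<forall>y\<in>carrier M. f (x \<oplus>\<^bsub>M\<^esub> y) = f x \<oplus>\<^bsub>N\<^esub> f y) \<and>
     (\<forall>a\<in>carrier k. \<forall>x\<in>carrier M. f (a \<odot>\<^bsub>M\<^esub> x) = a \<odot>\<^bsub>N\<^esub> f x)}"

record ('v, 'a, 'k, 'u) rep =
  vsp :: "'v \<Rightarrow> ('k, 'u) module"
  vmap :: "'a \<Rightarrow> 'u \<Rightarrow> 'u"

definition is_rep ::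
  "('k, 'r) ring_scheme \<Rightarrow> ('v, 'a) pre_digraph \<Rightarrow> ('v, 'a, 'k, 'u) rep \<Rightarrow> bool" where
  "is_rep k Q M \<longleftrightarrow>
     vsp M \<in> (\<Pi>\<^sub>E i\<in>verts Q. {V. module k V \<and> small TYPE('u) (carrier V)}) \<and>
     vmap M \<in> (\<Pi>\<^sub>E \<alpha>\<in>arcs Q. lin_maps k (vsp M (tail Q \<alpha>)) (vsp M (head Q \<alpha>)))"

definition rep_cat ::
  "('k, 'r) ring_scheme \<Rightarrow> ('v, 'a) pre_digraph \<Rightarrow>
     (('v, 'a, 'k, 'u) rep, 'v \<Rightarrow> 'u \<Rightarrow> 'u) cat" where
  "rep_cat k Q =
     \<lparr> Obj = {M. is_rep k Q M},
       Hom = (\<lambda>M N. {f \<in> (\<Pi>\<^sub>E i\<in>verts Q. lin_maps k (vsp M i) (vsp N i)).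
         \<forall>\<alpha>\<in>arcs Q. \<forall>x\<in>carrier (vsp M (tail Q \<alpha>)).
           f (head Q \<alpha>) (vmap M \<alpha> x) = vmap N \<alpha> (f (tail Q \<alpha>) x)}),
       Ident = (\<lambda>M. \<lambda>i\<in>verts Q. \<lambda>x\<in>carrier (vsp M i). x),
       Comp = (\<lambda>L M N g f. \<lambda>i\<in>verts Q. compose (carrier (vsp L i)) (g i) (f i)) \<rparr>"


section \<open>n-representations\<close>

text \<open>
  The quivers \<open>Q\<^sub>1, \<dots>, Q\<^sub>n\<close> are given as \<open>Q 1, \<dots>, Q n\<close>.
\<close>

abbreviation prod_rep_cat ::
  "('k, 'r) ring_scheme \<Rightarrow> nat \<Rightarrow> (nat \<Rightarrow> ('v, 'a) pre_digraph) \<Rightarrow>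
     (nat \<Rightarrow> ('v, 'a, 'k, 'u) rep, nat \<Rightarrow> 'v \<Rightarrow> 'u \<Rightarrow> 'u) cat" where
  "prod_rep_cat k n Q \<equiv> prod_cat {1..n} (\<lambda>m. rep_cat k (Q m))"

text \<open>\<open>link V m \<gamma> \<delta>\<close> is the map \<open>(\<psi>\<^sub>m)\<close> with lower index \<open>\<gamma>\<close> and upper index \<open>\<delta>\<close>.\<close>

record ('v, 'a, 'k, 'u) nrep =
  part :: "nat \<Rightarrow> ('v, 'a, 'k, 'u) rep"
  link :: "nat \<Rightarrow> 'a \<Rightarrow> 'a \<Rightarrow> 'u \<Rightarrow> 'u"

definition is_nrep ::
  "('k, 'r) ring_scheme \<Rightarrow> nat \<Rightarrow> (nat \<Rightarrow> ('v, 'a) pre_digraph) \<Rightarrow>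
     ('v, 'a, 'k, 'u) nrep \<Rightarrow> bool" where
  "is_nrep k n Q V \<longleftrightarrow>
     part V \<in> (\<Pi>\<^sub>E m\<in>{1..n}. {M. is_rep k (Q m) M}) \<and>
     link V \<in> (\<Pi>\<^sub>E m\<in>{1..n-1}. \<Pi>\<^sub>E \<gamma>\<in>arcs (Q m). \<Pi>\<^sub>E \<delta>\<in>arcs (Q (m+1)).
       lin_maps k (vsp (part V m) (head (Q m) \<gamma>)) (vsp (part V (m+1)) (tail (Q (m+1)) \<delta>)))"

definition nrep_cat ::
  "('k, 'r) ring_scheme \<Rightarrow> nat \<Rightarrow> (nat \<Rightarrow> ('v, 'a) pre_digraph) \<Rightarrow>
     (('v, 'a, 'k, 'u) nrep, nat \<Rightarrow> 'v \<Rightarrow> 'u \<Rightarrow> 'u) cat" where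
  "nrep_cat k n Q =
     \<lparr> Obj = {V. is_nrep k n Q V},
       Hom = (\<lambda>V W. {f \<in> (\<Pi>\<^sub>E m\<in>{1..n}. Hom (rep_cat k (Q m)) (part V m) (part W m)).
         \<forall>m\<in>{1..n-1}. \<forall>\<gamma>\<in>arcs (Q m). \<forall>\<delta>\<in>arcs (Q (m+1)).
           \<forall>x\<in>carrier (vsp (part V m) (head (Q m) \<gamma>)).
             f (m+1) (tail (Q (m+1)) \<delta>) (link V m \<gamma> \<delta> x) =
             link W m \<gamma> \<delta> (f m (head (Q m) \<gamma>) x)}),
       Ident = (\<lambda>V. Ident (prod_rep_cat k n Q) (part V)),
       Comp = (\<lambda>U V W. Comp (prod_rep_cat k n Q) (part U) (part V) (part W)) \<rparr>"

definition forget ::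
  "(('v, 'a, 'k, 'u) nrep, nat \<Rightarrow> 'v \<Rightarrow> 'u \<Rightarrow> 'u,
    nat \<Rightarrow> ('v, 'a, 'k, 'u) rep, nat \<Rightarrow> 'v \<Rightarrow> 'u \<Rightarrow> 'u) fct" where
  "forget = \<lparr> omap = part, mmap = (\<lambda>V W f. f) \<rparr>"

end

theory Submission
  imports Defs
begin

text \<open>
  An \<open>n\<close>-representation is a tuple of representations together with linear maps from some of their
  modules to others, and its morphisms are the morphisms of tuples that commute with these maps. Suppose
  that the underlying tuples of a diagram of \<open>n\<close>-representations have a colimit, and that each module
  from which a linking map starts is the colimit of the corresponding modules of the diagram. Then a
  linear map out of such a module amounts to a cocone, and the linking maps of the diagram induce exactly
  one family of linking maps on the colimit that is compatible with the legs. With it the tuple becomes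
  a colimit of \<open>n\<close>-representations: a factorization of tuples commutes with the linking maps since
  this can be checked after composing with the legs, which are jointly epic
  (\<open>inserter.colimit_lifts\<close>).

  What has to be shown is thus that the module of a colimit of representations at a vertex is a colimit
  of modules, for an arbitrary colimit of representations. Representations themselves are families of
  modules with linear maps between them, so the same lemma constructs one colimit that is computed vertex
  by vertex from colimits of modules (\<open>rep_cat_pointwise_colimit\<close>). Colimits are unique up to
  isomorphism, so evaluation at a vertex preserves all of them as soon as it preserves this one
  (\<open>preserves_colimit_if_preserves_one\<close>). The forgetful functor is treated in the same way.

  It remains to find colimits of small diagrams of modules with carriers in \<open>'u\<close>. They are built from
  finite formal sums of elements of the modules of the diagram, two sums being identified if every
  cocone gives them the same value (\<open>module_diagram.L_colimit\<close>). The assumptions on the universe make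
  the set of formal sums small.
\<close>

section \<open>Colimits in categories\<close>

lemma category_ident: "is_category C \<Longrightarrow> a \<in> Obj C \<Longrightarrow> Ident C a \<in> Hom C a a"
  unfolding is_category_def by blast

lemma category_comp:
  "is_category C \<Longrightarrow> a \<in> Obj C \<Longrightarrow> b \<in> Obj C \<Longrightarrow> c \<in> Obj C \<Longrightarrow> f \<in> Hom C a b \<Longrightarrow>
    g \<in> Hom C b c \<Longrightarrow> Comp C a b c g f \<in> Hom C a c"
  unfolding is_category_def by blast

lemma category_ident_right:
  "is_category C \<Longrightarrow> a \<in> Obj C \<Longrightarrow> b \<in> Obj C \<Longrightarrow> f \<in> Hom C a b \<Longrightarrow>
    Comp C a a b f (Ident C a) = f"
  unfolding is_category_def by blast

lemma category_ident_left:
  "is_category C \<Longrightarrow> a \<in> Obj C \<Longrightarrow> b \<in> Obj C \<Longrightarrow> f \<in> Hom C a b \<Longrightarrow>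
    Comp C a b b (Ident C b) f = f"
  unfolding is_category_def by blast

lemma category_assoc:
  "is_category C \<Longrightarrow> a \<in> Obj C \<Longrightarrow> b \<in> Obj C \<Longrightarrow> c \<in> Obj C \<Longrightarrow> d \<in> Obj C \<Longrightarrow>
    f \<in> Hom C a b \<Longrightarrow> g \<in> Hom C b c \<Longrightarrow> h \<in> Hom C c d \<Longrightarrow>
    Comp C a c d h (Comp C a b c g f) = Comp C a b d (Comp C b c d h g) f"
  unfolding is_category_def by blast

lemma functor_cod: "is_functor C D F \<Longrightarrow> is_category D"
  and functor_obj: "is_functor C D F \<Longrightarrow> a \<in> Obj C \<Longrightarrow> omap F a \<in> Obj D"
  and functor_hom: "is_functor C D F \<Longrightarrow> a \<in> Obj C \<Longrightarrow> b \<in> Obj C \<Longrightarrow> f \<in> Hom C a b \<Longrightarrow>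
    mmap F a b f \<in> Hom D (omap F a) (omap F b)"
  and functor_ident: "is_functor C D F \<Longrightarrow> a \<in> Obj C \<Longrightarrow>
    mmap F a a (Ident C a) = Ident D (omap F a)"
  and functor_comp: "is_functor C D F \<Longrightarrow> a \<in> Obj C \<Longrightarrow> b \<in> Obj C \<Longrightarrow> c \<in> Obj C \<Longrightarrow>
    f \<in> Hom C a b \<Longrightarrow> g \<in> Hom C b c \<Longrightarrow> mmap F a c (Comp C a b c g f) =
      Comp D (omap F a) (omap F b) (omap F c) (mmap F b c g) (mmap F a b f)"
  unfolding is_functor_def by blast+

lemma fct_comp_omap [simp]: "omap (fct_comp G F) a = omap G (omap F a)"
  and fct_comp_mmap [simp]:
    "mmap (fct_comp G F) a b f = mmap G (omap F a) (omap F b) (mmap F a b f)"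
  by (simp_all add: fct_comp_def)

lemma fct_comp_assoc: "fct_comp (fct_comp H G) F = fct_comp H (fct_comp G F)"
  by (simp add: fct_comp_def)

lemma functor_fct_comp:
  assumes "is_functor B C F" and "is_functor C D G"
  shows "is_functor B D (fct_comp G F)"
  using assms unfolding is_functor_def by simp

lemma cocone_obj: "is_cocone D C F L \<zeta> \<Longrightarrow> L \<in> Obj C"
  and cocone_leg: "is_cocone D C F L \<zeta> \<Longrightarrow> a \<in> Obj D \<Longrightarrow> \<zeta> a \<in> Hom C (omap F a) L"
  and cocone_comp: "is_cocone D C F L \<zeta> \<Longrightarrow> a \<in> Obj D \<Longrightarrow> b \<in> Obj D \<Longrightarrow> f \<in> Hom D a b \<Longrightarrow>
    Comp C (omap F a) (omap F b) L (\<zeta> b) (mmap F a b f) = \<zeta> a"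
  unfolding is_cocone_def by blast+

lemma colimit_cocone: "is_colimit D C F L \<zeta> \<Longrightarrow> is_cocone D C F L \<zeta>"
  unfolding is_colimit_def by blast

lemma colimit_factor:
  assumes "is_colimit D C F L \<zeta>" and "is_cocone D C F L' \<zeta>'"
  obtains u where "u \<in> Hom C L L'"
    and "\<And>a. a \<in> Obj D \<Longrightarrow> Comp C (omap F a) L L' u (\<zeta> a) = \<zeta>' a"
  using assms unfolding is_colimit_def by blast

lemma cocone_postcompose:
  assumes F: "is_functor D C F" and co: "is_cocone D C F L \<zeta>"
    and L': "L' \<in> Obj C" and u: "u \<in> Hom C L L'"
  shows "is_cocone D C F L' (\<lambda>a. Comp C (omap F a) L L' u (\<zeta> a))"
  unfolding is_cocone_def
proof (intro conjI ballI)
  note C = functor_cod[OF F] and L = cocone_obj[OF co]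
  show "L' \<in> Obj C" by fact
  fix a assume a: "a \<in> Obj D"
  show "Comp C (omap F a) L L' u (\<zeta> a) \<in> Hom C (omap F a) L'"
    using category_comp[OF C functor_obj[OF F a] L L' cocone_leg[OF co a] u] .
  fix b f assume b: "b \<in> Obj D" and f: "f \<in> Hom D a b"
  show "Comp C (omap F a) (omap F b) L' (Comp C (omap F b) L L' u (\<zeta> b)) (mmap F a b f) =
      Comp C (omap F a) L L' u (\<zeta> a)"
    using category_assoc[OF C functor_obj[OF F a] functor_obj[OF F b] L L'
        functor_hom[OF F a b f] cocone_leg[OF co b] u] cocone_comp[OF co a b f] by simp
qed

lemma colimit_legs_jointly_epic:
  assumes F: "is_functor D C F" and colim: "is_colimit D C F L \<zeta>"
    and L': "L' \<in> Obj C" and u: "u \<in> Hom C L L'" and v: "v \<in> Hom C L L'"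
    and eq: "\<And>a. a \<in> Obj D \<Longrightarrow>
      Comp C (omap F a) L L' u (\<zeta> a) = Comp C (omap F a) L L' v (\<zeta> a)"
  shows "u = v"
proof -
  have "is_cocone D C F L' (\<lambda>a. Comp C (omap F a) L L' u (\<zeta> a))"
    by (rule cocone_postcompose[OF F colimit_cocone[OF colim] L' u])
  then show ?thesis
    using colim u v eq unfolding is_colimit_def by (metis (no_types, lifting))
qed

lemma functor_cocone:
  assumes G: "is_functor C C' G" and F: "is_functor D C F" and co: "is_cocone D C F L \<zeta>"
  shows "is_cocone D C' (fct_comp G F) (omap G L) (\<lambda>a. mmap G (omap F a) L (\<zeta> a))"
  unfolding is_cocone_def fct_comp_omap fct_comp_mmap
proof (intro conjI ballI)
  note L = cocone_obj[OF co]
  show "omap G L \<in> Obj C'" by (rule functor_obj[OF G L])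
  fix a assume a: "a \<in> Obj D"
  show "mmap G (omap F a) L (\<zeta> a) \<in> Hom C' (omap G (omap F a)) (omap G L)"
    using functor_hom[OF G functor_obj[OF F a] L cocone_leg[OF co a]] .
  fix b f assume b: "b \<in> Obj D" and f: "f \<in> Hom D a b"
  show "Comp C' (omap G (omap F a)) (omap G (omap F b)) (omap G L) (mmap G (omap F b) L (\<zeta> b))
      (mmap G (omap F a) (omap F b) (mmap F a b f)) = mmap G (omap F a) L (\<zeta> a)"
    using functor_comp[OF G functor_obj[OF F a] functor_obj[OF F b] L
        functor_hom[OF F a b f] cocone_leg[OF co b]] cocone_comp[OF co a b f] by simp
qed

text \<open>
  Two colimits of the same diagram are isomorphic compatibly with their legs, and functors preserve
  isomorphisms. So a functor preserves all colimits of \<open>F\<close> as soon as it preserves a single one,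
  which may be chosen to be a convenient construction.
\<close>

lemma preserves_colimit_if_preserves_one:
  assumes G: "is_functor C C' G" and F: "is_functor D C F"
    and one: "is_colimit D C F L \<zeta>"
    and pres: "is_colimit D C' (fct_comp G F) (omap G L) (\<lambda>a. mmap G (omap F a) L (\<zeta> a))"
    and other: "is_colimit D C F M \<xi>"
  shows "is_colimit D C' (fct_comp G F) (omap G M) (\<lambda>a. mmap G (omap F a) M (\<xi> a))"
proof -
  note C = functor_cod[OF F] and C' = functor_cod[OF G]
    and L = cocone_obj[OF colimit_cocone[OF one]] and M = cocone_obj[OF colimit_cocone[OF other]]
    and GF = functor_fct_comp[OF F G]
  note GL = functor_obj[OF G L] and GM = functor_obj[OF G M]
  note \<zeta> = cocone_leg[OF colimit_cocone[OF one]] and \<xi> = cocone_leg[OF colimit_cocone[OF other]]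
  obtain u where u: "u \<in> Hom C L M"
    and u\<zeta>: "\<And>a. a \<in> Obj D \<Longrightarrow> Comp C (omap F a) L M u (\<zeta> a) = \<xi> a"
    using colimit_factor[OF one colimit_cocone[OF other]] by blast
  obtain v where v: "v \<in> Hom C M L"
    and v\<xi>: "\<And>a. a \<in> Obj D \<Longrightarrow> Comp C (omap F a) M L v (\<xi> a) = \<zeta> a"
    using colimit_factor[OF other colimit_cocone[OF one]] by blast
  have uv: "Comp C M L M u v = Ident C M"
  proof (rule colimit_legs_jointly_epic[OF F other M])
    show "Comp C M L M u v \<in> Hom C M M" by (rule category_comp[OF C M L M v u])
    show "Ident C M \<in> Hom C M M" by (rule category_ident[OF C M])
    fix a assume a: "a \<in> Obj D"
    show "Comp C (omap F a) M M (Comp C M L M u v) (\<xi> a) =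
        Comp C (omap F a) M M (Ident C M) (\<xi> a)"
      using category_assoc[OF C functor_obj[OF F a] M L M \<xi>[OF a] v u]
        v\<xi>[OF a] u\<zeta>[OF a] category_ident_left[OF C functor_obj[OF F a] M \<xi>[OF a]] by simp
  qed
  let ?u = "mmap G L M u" and ?v = "mmap G M L v"
  note Gu = functor_hom[OF G L M u] and Gv = functor_hom[OF G M L v]
  have Guv: "Comp C' (omap G M) (omap G L) (omap G M) ?u ?v = Ident C' (omap G M)"
    using functor_comp[OF G M L M v u] uv functor_ident[OF G M] by simp
  \<comment> \<open>A factorization through \<open>G L\<close> becomes one through \<open>G M\<close> by composing it with \<open>G v\<close>; it is
    unique because \<open>G u \<circ> G v = G (u \<circ> v)\<close> is the identity.\<close>
  show ?thesis
    unfolding is_colimit_def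
  proof (intro conjI allI impI)
    show "is_cocone D C' (fct_comp G F) (omap G M) (\<lambda>a. mmap G (omap F a) M (\<xi> a))"
      by (rule functor_cocone[OF G F colimit_cocone[OF other]])
    fix N \<eta> assume co: "is_cocone D C' (fct_comp G F) N \<eta>"
    note N = cocone_obj[OF co]
    obtain w where w: "w \<in> Hom C' (omap G L) N"
      and w\<zeta>: "\<And>a. a \<in> Obj D \<Longrightarrow> Comp C' (omap (fct_comp G F) a) (omap G L) N w
        (mmap G (omap F a) L (\<zeta> a)) = \<eta> a"
      using colimit_factor[OF pres co] by blast
    let ?wv = "Comp C' (omap G M) (omap G L) N w ?v"
    show "\<exists>!u. u \<in> Hom C' (omap G M) N \<and> (\<forall>a\<in>Obj D. Comp C' (omap (fct_comp G F) a) (omap G M) N u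
        (mmap G (omap F a) M (\<xi> a)) = \<eta> a)"
    proof (rule ex1I[of _ ?wv], intro conjI ballI)
      show "?wv \<in> Hom C' (omap G M) N" by (rule category_comp[OF C' GM GL N Gv w])
      fix a assume a: "a \<in> Obj D"
      note Fa = functor_obj[OF F a]
      show "Comp C' (omap (fct_comp G F) a) (omap G M) N ?wv (mmap G (omap F a) M (\<xi> a)) = \<eta> a"
        using category_assoc[OF C' functor_obj[OF G Fa] GM GL N
            functor_hom[OF G Fa M \<xi>[OF a]] Gv w]
          functor_comp[OF G Fa M L \<xi>[OF a] v] v\<xi>[OF a] w\<zeta>[OF a] by simp
    next
      fix w' assume w': "w' \<in> Hom C' (omap G M) N \<and> (\<forall>a\<in>Obj D. Comp C' (omap (fct_comp G F) a)
          (omap G M) N w' (mmap G (omap F a) M (\<xi> a)) = \<eta> a)"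
      have "Comp C' (omap G L) (omap G M) N w' ?u = w"
      proof (rule colimit_legs_jointly_epic[OF GF pres N _ w])
        show "Comp C' (omap G L) (omap G M) N w' ?u \<in> Hom C' (omap G L) N"
          using category_comp[OF C' GL GM N Gu] w' by blast
        fix a assume a: "a \<in> Obj D"
        note Fa = functor_obj[OF F a]
        show "Comp C' (omap (fct_comp G F) a) (omap G L) N (Comp C' (omap G L) (omap G M) N w' ?u)
            (mmap G (omap F a) L (\<zeta> a)) =
          Comp C' (omap (fct_comp G F) a) (omap G L) N w (mmap G (omap F a) L (\<zeta> a))"
          using category_assoc[OF C' functor_obj[OF G Fa] GL GM N
              functor_hom[OF G Fa L \<zeta>[OF a]] Gu conjunct1[OF w'], symmetric]
            functor_comp[OF G Fa L M \<zeta>[OF a] u, symmetric] u\<zeta>[OF a] w\<zeta>[OF a] w' a by simp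
      qed
      then show "w' = ?wv"
        using category_assoc[OF C' GM GL GM N Gv Gu conjunct1[OF w']] Guv
          category_ident_right[OF C' GM N conjunct1[OF w']] by simp
    qed
  qed
qed


section \<open>Products of categories\<close>

lemma prod_cat_simps [simp]:
  "Obj (prod_cat I C) = (\<Pi>\<^sub>E i\<in>I. Obj (C i))"
  "Hom (prod_cat I C) a b = (\<Pi>\<^sub>E i\<in>I. Hom (C i) (a i) (b i))"
  "Ident (prod_cat I C) a = (\<lambda>i\<in>I. Ident (C i) (a i))"
  "Comp (prod_cat I C) a b c g f = (\<lambda>i\<in>I. Comp (C i) (a i) (b i) (c i) (g i) (f i))"
  by (simp_all add: prod_cat_def)

lemma proj_fct_simps [simp]: "omap (proj_fct i) a = a i" "mmap (proj_fct i) a b f = f i"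
  by (simp_all add: proj_fct_def)

lemma prod_cat_category:
  assumes "\<And>i. i \<in> I \<Longrightarrow> is_category (C i)"
  shows "is_category (prod_cat I C)"
  unfolding is_category_def prod_cat_simps
proof (intro conjI ballI)
  fix a assume a: "a \<in> (\<Pi>\<^sub>E i\<in>I. Obj (C i))"
  show "(\<lambda>i\<in>I. Ident (C i) (a i)) \<in> (\<Pi>\<^sub>E i\<in>I. Hom (C i) (a i) (a i))"
    using a assms by (auto intro: category_ident)
  fix b assume b: "b \<in> (\<Pi>\<^sub>E i\<in>I. Obj (C i))"
  {
    fix f assume f: "f \<in> (\<Pi>\<^sub>E i\<in>I. Hom (C i) (a i) (b i))"
    show "(\<lambda>i\<in>I. Comp (C i) (a i) (a i) (b i) (f i) ((\<lambda>i\<in>I. Ident (C i) (a i)) i)) = f"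
      by (rule extensionalityI[of _ I])
        (use a b f assms in \<open>auto simp: PiE_mem PiE_def intro: category_ident_right\<close>)
    show "(\<lambda>i\<in>I. Comp (C i) (a i) (b i) (b i) ((\<lambda>i\<in>I. Ident (C i) (b i)) i) (f i)) = f"
      by (rule extensionalityI[of _ I])
        (use a b f assms in \<open>auto simp: PiE_mem PiE_def intro: category_ident_left\<close>)
  }
  fix c assume c: "c \<in> (\<Pi>\<^sub>E i\<in>I. Obj (C i))"
  fix f g assume f: "f \<in> (\<Pi>\<^sub>E i\<in>I. Hom (C i) (a i) (b i))"
    and g: "g \<in> (\<Pi>\<^sub>E i\<in>I. Hom (C i) (b i) (c i))"
  show "(\<lambda>i\<in>I. Comp (C i) (a i) (b i) (c i) (g i) (f i)) \<in> (\<Pi>\<^sub>E i\<in>I. Hom (C i) (a i) (c i))"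
    using a b c f g assms by (auto simp: PiE_mem intro!: category_comp)
  fix d h assume d: "d \<in> (\<Pi>\<^sub>E i\<in>I. Obj (C i))" and h: "h \<in> (\<Pi>\<^sub>E i\<in>I. Hom (C i) (c i) (d i))"
  show "(\<lambda>i\<in>I. Comp (C i) (a i) (c i) (d i) (h i)
      ((\<lambda>i\<in>I. Comp (C i) (a i) (b i) (c i) (g i) (f i)) i)) =
    (\<lambda>i\<in>I. Comp (C i) (a i) (b i) (d i)
      ((\<lambda>i\<in>I. Comp (C i) (b i) (c i) (d i) (h i) (g i)) i) (f i))"
  proof (rule restrict_ext)
    fix i assume i: "i \<in> I"
    show "Comp (C i) (a i) (c i) (d i) (h i)
        ((\<lambda>i\<in>I. Comp (C i) (a i) (b i) (c i) (g i) (f i)) i) =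
      Comp (C i) (a i) (b i) (d i) ((\<lambda>i\<in>I. Comp (C i) (b i) (c i) (d i) (h i) (g i)) i) (f i)"
      using category_assoc[OF assms[OF i] PiE_mem[OF a i] PiE_mem[OF b i] PiE_mem[OF c i]
          PiE_mem[OF d i] PiE_mem[OF f i] PiE_mem[OF g i] PiE_mem[OF h i]] i by simp
  qed
qed

lemma proj_functor:
  assumes "\<And>i. i \<in> I \<Longrightarrow> is_category (C i)" and "m \<in> I"
  shows "is_functor (prod_cat I C) (C m) (proj_fct m)"
  unfolding is_functor_def using prod_cat_category[of I C] assms by (auto simp: PiE_mem)

text \<open>
  Objects, morphisms and composition of a product are componentwise, so a cocone over \<open>F\<close> is a family
  of cocones over the components of \<open>F\<close>, and the factorizations can be chosen component by component.
\<close>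

lemma colimit_prod_cat:
  assumes F: "is_functor D (prod_cat I C) F"
    and colim: "\<And>i. i \<in> I \<Longrightarrow> is_colimit D (C i) (fct_comp (proj_fct i) F) (L i) (\<zeta> i)"
  shows "is_colimit D (prod_cat I C) F (restrict L I) (\<lambda>d. \<lambda>i\<in>I. \<zeta> i d)"
  unfolding is_colimit_def
proof (intro conjI allI impI)
  note co = colimit_cocone[OF colim]
  show "is_cocone D (prod_cat I C) F (restrict L I) (\<lambda>d. \<lambda>i\<in>I. \<zeta> i d)"
    unfolding is_cocone_def prod_cat_simps
  proof (intro conjI ballI)
    show "restrict L I \<in> (\<Pi>\<^sub>E i\<in>I. Obj (C i))" using cocone_obj[OF co] by auto
    fix a assume a: "a \<in> Obj D"
    show "(\<lambda>i\<in>I. \<zeta> i a) \<in> (\<Pi>\<^sub>E i\<in>I. Hom (C i) (omap F a i) (restrict L I i))"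
      using cocone_leg[OF co a] by auto
    fix b f assume b: "b \<in> Obj D" and f: "f \<in> Hom D a b"
    show "(\<lambda>i\<in>I. Comp (C i) (omap F a i) (omap F b i) (restrict L I i)
        ((\<lambda>i\<in>I. \<zeta> i b) i) (mmap F a b f i)) = (\<lambda>i\<in>I. \<zeta> i a)"
      by (rule restrict_ext) (use cocone_comp[OF co a b f] in auto)
  qed
  fix L' \<zeta>' assume co': "is_cocone D (prod_cat I C) F L' \<zeta>'"
  have "is_cocone D (C i) (fct_comp (proj_fct i) F) (L' i) (\<lambda>d. \<zeta>' d i)" if i: "i \<in> I" for i
    unfolding is_cocone_def fct_comp_omap fct_comp_mmap proj_fct_simps
  proof (intro conjI ballI)
    show "L' i \<in> Obj (C i)" using cocone_obj[OF co'] i by auto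
    fix a assume a: "a \<in> Obj D"
    show "\<zeta>' a i \<in> Hom (C i) (omap F a i) (L' i)" using cocone_leg[OF co' a] i by auto
    fix b f assume b: "b \<in> Obj D" and f: "f \<in> Hom D a b"
    show "Comp (C i) (omap F a i) (omap F b i) (L' i) (\<zeta>' b i) (mmap F a b f i) = \<zeta>' a i"
      using fun_cong[OF cocone_comp[OF co' a b f], of i] i by simp
  qed
  then have "\<forall>i\<in>I. \<exists>!u. u \<in> Hom (C i) (L i) (L' i) \<and>
      (\<forall>a\<in>Obj D. Comp (C i) (omap F a i) (L i) (L' i) u (\<zeta> i a) = \<zeta>' a i)"
    using colim unfolding is_colimit_def by simp
  then obtain u where u: "\<And>i. i \<in> I \<Longrightarrow> u i \<in> Hom (C i) (L i) (L' i) \<and>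
      (\<forall>a\<in>Obj D. Comp (C i) (omap F a i) (L i) (L' i) (u i) (\<zeta> i a) = \<zeta>' a i)"
    and unique: "\<And>i v. i \<in> I \<Longrightarrow> v \<in> Hom (C i) (L i) (L' i) \<Longrightarrow>
      (\<forall>a\<in>Obj D. Comp (C i) (omap F a i) (L i) (L' i) v (\<zeta> i a) = \<zeta>' a i) \<Longrightarrow> v = u i"
    unfolding Ex1_def by metis
  show "\<exists>!u. u \<in> Hom (prod_cat I C) (restrict L I) L' \<and> (\<forall>a\<in>Obj D.
      Comp (prod_cat I C) (omap F a) (restrict L I) L' u (\<lambda>i\<in>I. \<zeta> i a) = \<zeta>' a)"
    unfolding prod_cat_simps
  proof (rule ex1I[of _ "restrict u I"], intro conjI ballI)
    show "restrict u I \<in> (\<Pi>\<^sub>E i\<in>I. Hom (C i) (restrict L I i) (L' i))" using u by auto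
    fix a assume a: "a \<in> Obj D"
    show "(\<lambda>i\<in>I. Comp (C i) (omap F a i) (restrict L I i) (L' i) (restrict u I i)
        ((\<lambda>i\<in>I. \<zeta> i a) i)) = \<zeta>' a"
      by (rule extensionalityI[of _ I])
        (use u a cocone_leg[OF co' a] in \<open>auto simp: PiE_def\<close>)
  next
    fix v assume v: "v \<in> (\<Pi>\<^sub>E i\<in>I. Hom (C i) (restrict L I i) (L' i)) \<and>
      (\<forall>a\<in>Obj D. (\<lambda>i\<in>I. Comp (C i) (omap F a i) (restrict L I i) (L' i) (v i)
        ((\<lambda>i\<in>I. \<zeta> i a) i)) = \<zeta>' a)"
    show "v = restrict u I"
    proof (rule extensionalityI[of _ I])
      show "v \<in> extensional I" using v by (simp add: PiE_def)
      fix i assume i: "i \<in> I"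
      have "v i = u i"
      proof (rule unique[OF i])
        show "v i \<in> Hom (C i) (L i) (L' i)" using v i by (auto simp: PiE_def Pi_def)
        show "\<forall>a\<in>Obj D. Comp (C i) (omap F a i) (L i) (L' i) (v i) (\<zeta> i a) = \<zeta>' a i"
        proof
          fix a assume "a \<in> Obj D"
          then have "(\<lambda>i\<in>I. Comp (C i) (omap F a i) (restrict L I i) (L' i) (v i)
            ((\<lambda>i\<in>I. \<zeta> i a) i)) i = \<zeta>' a i" using v by simp
          then show "Comp (C i) (omap F a i) (L i) (L' i) (v i) (\<zeta> i a) = \<zeta>' a i"
            using i by simp
        qed
      qed
      then show "v i = restrict u I i" using i by simp
    qed simp
  qed
qed


section \<open>Inserter categories\<close>

text \<open>
  Representations are families of modules together with linear maps between them, and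
  \<open>n\<close>-representations are families of representations together with linear maps between some of their
  modules. Both are instances of one construction: an object of \<open>C\<close> is an object \<open>p\<close> of a category
  \<open>P\<close> with a family of morphisms \<open>S \<alpha> p \<rightarrow> T \<alpha> p\<close> of \<open>M\<close>, where \<open>S \<alpha>\<close> and \<open>T \<alpha>\<close> are functors from
  \<open>P\<close> to \<open>M\<close>; a morphism of \<open>C\<close> is a morphism of \<open>P\<close> that commutes with these families.
\<close>

locale inserter =
  fixes C :: "('o, 'm) cat" and P :: "('p, 'm) cat" and M :: "('x, 'y) cat"
    and A :: "'i set" and S T :: "'i \<Rightarrow> ('p, 'm, 'x, 'y) fct"
    and ob :: "'o \<Rightarrow> 'p" and str :: "'o \<Rightarrow> 'i \<Rightarrow> 'y"
  assumes base_category: "is_category P"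
    and S_functor: "\<And>\<alpha>. \<alpha> \<in> A \<Longrightarrow> is_functor P M (S \<alpha>)"
    and T_functor: "\<And>\<alpha>. \<alpha> \<in> A \<Longrightarrow> is_functor P M (T \<alpha>)"
    and ob_obj: "\<And>V. V \<in> Obj C \<Longrightarrow> ob V \<in> Obj P"
    and str_hom: "\<And>V \<alpha>. V \<in> Obj C \<Longrightarrow> \<alpha> \<in> A \<Longrightarrow>
      str V \<alpha> \<in> Hom M (omap (S \<alpha>) (ob V)) (omap (T \<alpha>) (ob V))"
    and lift: "\<And>p \<tau>. p \<in> Obj P \<Longrightarrow>
      (\<And>\<alpha>. \<alpha> \<in> A \<Longrightarrow> \<tau> \<alpha> \<in> Hom M (omap (S \<alpha>) p) (omap (T \<alpha>) p)) \<Longrightarrow>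
      \<exists>V\<in>Obj C. ob V = p \<and> (\<forall>\<alpha>\<in>A. str V \<alpha> = \<tau> \<alpha>)"
    and Hom_iff: "\<And>V W f. V \<in> Obj C \<Longrightarrow> W \<in> Obj C \<Longrightarrow>
      f \<in> Hom C V W \<longleftrightarrow> f \<in> Hom P (ob V) (ob W) \<and>
        (\<forall>\<alpha>\<in>A. Comp M (omap (S \<alpha>) (ob V)) (omap (T \<alpha>) (ob V)) (omap (T \<alpha>) (ob W))
            (mmap (T \<alpha>) (ob V) (ob W) f) (str V \<alpha>) =
          Comp M (omap (S \<alpha>) (ob V)) (omap (S \<alpha>) (ob W)) (omap (T \<alpha>) (ob W))
            (str W \<alpha>) (mmap (S \<alpha>) (ob V) (ob W) f))"
    and Ident_eq: "\<And>V. V \<in> Obj C \<Longrightarrow> Ident C V = Ident P (ob V)"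
    and Comp_eq: "\<And>V W Z. V \<in> Obj C \<Longrightarrow> W \<in> Obj C \<Longrightarrow> Z \<in> Obj C \<Longrightarrow>
      Comp C V W Z = Comp P (ob V) (ob W) (ob Z)"
begin

lemma Hom_base: "V \<in> Obj C \<Longrightarrow> W \<in> Obj C \<Longrightarrow> f \<in> Hom C V W \<Longrightarrow> f \<in> Hom P (ob V) (ob W)"
  by (simp add: Hom_iff)

lemma Hom_commutes:
  "V \<in> Obj C \<Longrightarrow> W \<in> Obj C \<Longrightarrow> f \<in> Hom C V W \<Longrightarrow> \<alpha> \<in> A \<Longrightarrow>
    Comp M (omap (S \<alpha>) (ob V)) (omap (T \<alpha>) (ob V)) (omap (T \<alpha>) (ob W))
      (mmap (T \<alpha>) (ob V) (ob W) f) (str V \<alpha>) =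
    Comp M (omap (S \<alpha>) (ob V)) (omap (S \<alpha>) (ob W)) (omap (T \<alpha>) (ob W))
      (str W \<alpha>) (mmap (S \<alpha>) (ob V) (ob W) f)"
  by (simp add: Hom_iff)

lemma Ident_in_Hom:
  assumes V: "V \<in> Obj C"
  shows "Ident C V \<in> Hom C V V"
  unfolding Hom_iff[OF V V] Ident_eq[OF V]
proof (intro conjI ballI)
  note oV = ob_obj[OF V]
  show "Ident P (ob V) \<in> Hom P (ob V) (ob V)" by (rule category_ident[OF base_category oV])
  fix \<alpha> assume \<alpha>: "\<alpha> \<in> A"
  note S = S_functor[OF \<alpha>] and T = T_functor[OF \<alpha>]
  note M = functor_cod[OF S] and SV = functor_obj[OF S oV] and TV = functor_obj[OF T oV]
  show "Comp M (omap (S \<alpha>) (ob V)) (omap (T \<alpha>) (ob V)) (omap (T \<alpha>) (ob V))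
      (mmap (T \<alpha>) (ob V) (ob V) (Ident P (ob V))) (str V \<alpha>) =
    Comp M (omap (S \<alpha>) (ob V)) (omap (S \<alpha>) (ob V)) (omap (T \<alpha>) (ob V))
      (str V \<alpha>) (mmap (S \<alpha>) (ob V) (ob V) (Ident P (ob V)))"
    using functor_ident[OF S oV] functor_ident[OF T oV]
      category_ident_left[OF M SV TV str_hom[OF V \<alpha>]]
      category_ident_right[OF M SV TV str_hom[OF V \<alpha>]] by simp
qed

lemma Comp_in_Hom:
  assumes V: "V \<in> Obj C" and W: "W \<in> Obj C" and Z: "Z \<in> Obj C"
    and f: "f \<in> Hom C V W" and g: "g \<in> Hom C W Z"
  shows "Comp C V W Z g f \<in> Hom C V Z"
  unfolding Hom_iff[OF V Z] Comp_eq[OF V W Z]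
proof (intro conjI ballI)
  note oV = ob_obj[OF V] and oW = ob_obj[OF W] and oZ = ob_obj[OF Z]
  note pf = Hom_base[OF V W f] and pg = Hom_base[OF W Z g]
  show "Comp P (ob V) (ob W) (ob Z) g f \<in> Hom P (ob V) (ob Z)"
    by (rule category_comp[OF base_category oV oW oZ pf pg])
  fix \<alpha> assume \<alpha>: "\<alpha> \<in> A"
  note S = S_functor[OF \<alpha>] and T = T_functor[OF \<alpha>]
  note M = functor_cod[OF S]
    and SV = functor_obj[OF S oV] and SW = functor_obj[OF S oW] and SZ = functor_obj[OF S oZ]
    and TV = functor_obj[OF T oV] and TW = functor_obj[OF T oW] and TZ = functor_obj[OF T oZ]
    and Sf = functor_hom[OF S oV oW pf] and Sg = functor_hom[OF S oW oZ pg]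
    and Tf = functor_hom[OF T oV oW pf] and Tg = functor_hom[OF T oW oZ pg]
  show "Comp M (omap (S \<alpha>) (ob V)) (omap (T \<alpha>) (ob V)) (omap (T \<alpha>) (ob Z))
      (mmap (T \<alpha>) (ob V) (ob Z) (Comp P (ob V) (ob W) (ob Z) g f)) (str V \<alpha>) =
    Comp M (omap (S \<alpha>) (ob V)) (omap (S \<alpha>) (ob Z)) (omap (T \<alpha>) (ob Z))
      (str Z \<alpha>) (mmap (S \<alpha>) (ob V) (ob Z) (Comp P (ob V) (ob W) (ob Z) g f))"
    unfolding functor_comp[OF S oV oW oZ pf pg] functor_comp[OF T oV oW oZ pf pg]
      category_assoc[OF M SV TV TW TZ str_hom[OF V \<alpha>] Tf Tg, symmetric]
      Hom_commutes[OF V W f \<alpha>]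
      category_assoc[OF M SV SW TW TZ Sf str_hom[OF W \<alpha>] Tg]
      Hom_commutes[OF W Z g \<alpha>]
      category_assoc[OF M SV SW SZ TZ Sf Sg str_hom[OF Z \<alpha>], symmetric] ..
qed

lemma category: "is_category C"
  unfolding is_category_def
proof (intro conjI ballI)
  fix V assume V: "V \<in> Obj C"
  show "Ident C V \<in> Hom C V V" by (rule Ident_in_Hom[OF V])
  fix W assume W: "W \<in> Obj C"
  {
    fix f assume f: "f \<in> Hom C V W"
    show "Comp C V V W f (Ident C V) = f"
      using category_ident_right[OF base_category ob_obj[OF V] ob_obj[OF W] Hom_base[OF V W f]]
      by (simp add: Comp_eq Ident_eq V W)
    show "Comp C V W W (Ident C W) f = f"
      using category_ident_left[OF base_category ob_obj[OF V] ob_obj[OF W] Hom_base[OF V W f]]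
      by (simp add: Comp_eq Ident_eq V W)
  }
  fix Z f g assume Z: "Z \<in> Obj C" and f: "f \<in> Hom C V W" and g: "g \<in> Hom C W Z"
  show "Comp C V W Z g f \<in> Hom C V Z" by (rule Comp_in_Hom[OF V W Z f g])
  fix R h assume R: "R \<in> Obj C" and h: "h \<in> Hom C Z R"
  show "Comp C V Z R h (Comp C V W Z g f) = Comp C V W R (Comp C W Z R h g) f"
    using category_assoc[OF base_category ob_obj[OF V] ob_obj[OF W] ob_obj[OF Z] ob_obj[OF R]
        Hom_base[OF V W f] Hom_base[OF W Z g] Hom_base[OF Z R h]]
    by (simp add: Comp_eq V W Z R)
qed

definition U :: "('o, 'm, 'p, 'm) fct" where
  "U = \<lparr> omap = ob, mmap = (\<lambda>V W f. f) \<rparr>"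

lemma U_simps [simp]: "omap U V = ob V" "mmap U V W f = f"
  by (simp_all add: U_def)

lemma U_functor: "is_functor C P U"
  unfolding is_functor_def using category base_category
  by (simp add: ob_obj Hom_base Ident_eq Comp_eq)

text \<open>
  If all \<open>S \<alpha>\<close> preserve a colimit \<open>p\<close> of the underlying diagram, then a morphism out of \<open>S \<alpha> p\<close> is
  the same as a cocone over the image of the diagram under \<open>S \<alpha>\<close>. The structure morphisms of the
  objects of the diagram, followed by the images of the legs under \<open>T \<alpha>\<close>, form such a cocone, so
  there is exactly one structure on \<open>p\<close> for which the legs are morphisms of \<open>C\<close>. Every factorization
  in \<open>P\<close> is then a morphism of \<open>C\<close>, because the legs out of \<open>S \<alpha> p\<close> are jointly epic.
\<close>

lemma colimit_lifts:
  assumes F: "is_functor D C F"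
    and colim: "is_colimit D P (fct_comp U F) p \<zeta>"
    and pres: "\<And>\<alpha>. \<alpha> \<in> A \<Longrightarrow> is_colimit D M (fct_comp (S \<alpha>) (fct_comp U F)) (omap (S \<alpha>) p)
      (\<lambda>d. mmap (S \<alpha>) (ob (omap F d)) p (\<zeta> d))"
  obtains V where "V \<in> Obj C" and "ob V = p" and "is_colimit D C F V \<zeta>"
proof -
  note UF = functor_fct_comp[OF F U_functor] and co = colimit_cocone[OF colim]
  note p = cocone_obj[OF co]
  have Fo: "omap F a \<in> Obj C" and oF: "ob (omap F a) \<in> Obj P"
    and \<zeta>: "\<zeta> a \<in> Hom P (ob (omap F a)) p" if "a \<in> Obj D" for a
    using functor_obj[OF F that] ob_obj[OF functor_obj[OF F that]] cocone_leg[OF co that] by auto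
  have "\<exists>\<tau>. \<tau> \<in> Hom M (omap (S \<alpha>) p) (omap (T \<alpha>) p) \<and> (\<forall>a\<in>Obj D.
      Comp M (omap (S \<alpha>) (ob (omap F a))) (omap (S \<alpha>) p) (omap (T \<alpha>) p) \<tau>
        (mmap (S \<alpha>) (ob (omap F a)) p (\<zeta> a)) =
      Comp M (omap (S \<alpha>) (ob (omap F a))) (omap (T \<alpha>) (ob (omap F a))) (omap (T \<alpha>) p)
        (mmap (T \<alpha>) (ob (omap F a)) p (\<zeta> a)) (str (omap F a) \<alpha>))" if \<alpha>: "\<alpha> \<in> A" for \<alpha>
  proof -
    let ?\<kappa> = "\<lambda>a. Comp M (omap (S \<alpha>) (ob (omap F a))) (omap (T \<alpha>) (ob (omap F a)))
      (omap (T \<alpha>) p) (mmap (T \<alpha>) (ob (omap F a)) p (\<zeta> a)) (str (omap F a) \<alpha>)"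
    note S = S_functor[OF \<alpha>] and T = T_functor[OF \<alpha>]
    note M = functor_cod[OF S] and Tp = functor_obj[OF T p]
    have "is_cocone D M (fct_comp (S \<alpha>) (fct_comp U F)) (omap (T \<alpha>) p) ?\<kappa>"
      unfolding is_cocone_def fct_comp_omap fct_comp_mmap U_simps
    proof (intro conjI ballI)
      show "omap (T \<alpha>) p \<in> Obj M" by (rule Tp)
      fix a assume a: "a \<in> Obj D"
      note Sa = functor_obj[OF S oF[OF a]] and Ta = functor_obj[OF T oF[OF a]]
        and T\<zeta>a = functor_hom[OF T oF[OF a] p \<zeta>[OF a]] and stra = str_hom[OF Fo[OF a] \<alpha>]
      show "?\<kappa> a \<in> Hom M (omap (S \<alpha>) (ob (omap F a))) (omap (T \<alpha>) p)"
        by (rule category_comp[OF M Sa Ta Tp stra T\<zeta>a])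
      fix b f assume b: "b \<in> Obj D" and f: "f \<in> Hom D a b"
      note Sb = functor_obj[OF S oF[OF b]] and Tb = functor_obj[OF T oF[OF b]]
        and T\<zeta>b = functor_hom[OF T oF[OF b] p \<zeta>[OF b]] and strb = str_hom[OF Fo[OF b] \<alpha>]
        and Ff = functor_hom[OF F a b f]
      note Pf = Hom_base[OF Fo[OF a] Fo[OF b] Ff]
      note Sf = functor_hom[OF S oF[OF a] oF[OF b] Pf]
        and Tf = functor_hom[OF T oF[OF a] oF[OF b] Pf]
      have \<zeta>f: "Comp P (ob (omap F a)) (ob (omap F b)) p (\<zeta> b) (mmap F a b f) = \<zeta> a"
        using cocone_comp[OF co a b f] by simp
      show "Comp M (omap (S \<alpha>) (ob (omap F a))) (omap (S \<alpha>) (ob (omap F b))) (omap (T \<alpha>) p)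
          (?\<kappa> b) (mmap (S \<alpha>) (ob (omap F a)) (ob (omap F b)) (mmap F a b f)) = ?\<kappa> a"
        unfolding category_assoc[OF M Sa Sb Tb Tp Sf strb T\<zeta>b, symmetric]
          Hom_commutes[OF Fo[OF a] Fo[OF b] Ff \<alpha>, symmetric]
          category_assoc[OF M Sa Ta Tb Tp stra Tf T\<zeta>b]
          functor_comp[OF T oF[OF a] oF[OF b] p Pf \<zeta>[OF b], symmetric] \<zeta>f ..
    qed
    from colimit_factor[OF pres[OF \<alpha>] this] show ?thesis
      by (metis fct_comp_omap U_simps(1))
  qed
  then obtain \<tau> where \<tau>: "\<And>\<alpha>. \<alpha> \<in> A \<Longrightarrow> \<tau> \<alpha> \<in> Hom M (omap (S \<alpha>) p) (omap (T \<alpha>) p)"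
    and \<tau>\<zeta>: "\<And>\<alpha> a. \<alpha> \<in> A \<Longrightarrow> a \<in> Obj D \<Longrightarrow>
      Comp M (omap (S \<alpha>) (ob (omap F a))) (omap (S \<alpha>) p) (omap (T \<alpha>) p) (\<tau> \<alpha>)
        (mmap (S \<alpha>) (ob (omap F a)) p (\<zeta> a)) =
      Comp M (omap (S \<alpha>) (ob (omap F a))) (omap (T \<alpha>) (ob (omap F a))) (omap (T \<alpha>) p)
        (mmap (T \<alpha>) (ob (omap F a)) p (\<zeta> a)) (str (omap F a) \<alpha>)"
    by metis
  obtain V where V: "V \<in> Obj C" and oV: "ob V = p"
    and strV: "\<And>\<alpha>. \<alpha> \<in> A \<Longrightarrow> str V \<alpha> = \<tau> \<alpha>"
    using lift[OF p \<tau>] by blast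
  have \<zeta>V: "\<zeta> a \<in> Hom C (omap F a) V" if a: "a \<in> Obj D" for a
    unfolding Hom_iff[OF Fo[OF a] V] oV using \<zeta>[OF a] \<tau>\<zeta>[OF _ a] strV by simp
  have "is_colimit D C F V \<zeta>"
    unfolding is_colimit_def
  proof (intro conjI allI impI)
    show "is_cocone D C F V \<zeta>"
      unfolding is_cocone_def
    proof (intro conjI ballI)
      fix a b f assume a: "a \<in> Obj D" and b: "b \<in> Obj D" and f: "f \<in> Hom D a b"
      show "Comp C (omap F a) (omap F b) V (\<zeta> b) (mmap F a b f) = \<zeta> a"
        using cocone_comp[OF co a b f] by (simp add: Comp_eq[OF Fo[OF a] Fo[OF b] V] oV)
    qed (use V \<zeta>V in auto)
    fix W \<xi> assume coW: "is_cocone D C F W \<xi>"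
    note W = cocone_obj[OF coW] and \<xi> = cocone_leg[OF coW]
    note oW = ob_obj[OF W]
    have "is_cocone D P (fct_comp U F) (ob W) \<xi>"
      using functor_cocone[OF U_functor F coW] by simp
    then obtain u where u: "u \<in> Hom P p (ob W)"
      and u\<zeta>: "\<And>a. a \<in> Obj D \<Longrightarrow> Comp P (ob (omap F a)) p (ob W) u (\<zeta> a) = \<xi> a"
      using colimit_factor[OF colim] by (metis fct_comp_omap U_simps(1))
    have uC: "u \<in> Hom C V W"
      unfolding Hom_iff[OF V W] oV
    proof (intro conjI ballI)
      show "u \<in> Hom P p (ob W)" by (rule u)
      fix \<alpha> assume \<alpha>: "\<alpha> \<in> A"
      note S = S_functor[OF \<alpha>] and T = T_functor[OF \<alpha>]
      note M = functor_cod[OF S]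
        and Sp = functor_obj[OF S p] and SW = functor_obj[OF S oW]
        and Tp = functor_obj[OF T p] and TW = functor_obj[OF T oW]
        and Su = functor_hom[OF S p oW u] and Tu = functor_hom[OF T p oW u]
        and \<tau>\<alpha> = \<tau>[OF \<alpha>] and strW = str_hom[OF W \<alpha>]
      show "Comp M (omap (S \<alpha>) p) (omap (T \<alpha>) p) (omap (T \<alpha>) (ob W))
          (mmap (T \<alpha>) p (ob W) u) (str V \<alpha>) =
        Comp M (omap (S \<alpha>) p) (omap (S \<alpha>) (ob W)) (omap (T \<alpha>) (ob W))
          (str W \<alpha>) (mmap (S \<alpha>) p (ob W) u)"
        unfolding strV[OF \<alpha>]
      proof (rule colimit_legs_jointly_epic[OF functor_fct_comp[OF UF S] pres[OF \<alpha>] TW])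
        show "Comp M (omap (S \<alpha>) p) (omap (T \<alpha>) p) (omap (T \<alpha>) (ob W))
            (mmap (T \<alpha>) p (ob W) u) (\<tau> \<alpha>) \<in> Hom M (omap (S \<alpha>) p) (omap (T \<alpha>) (ob W))"
          by (rule category_comp[OF M Sp Tp TW \<tau>\<alpha> Tu])
        show "Comp M (omap (S \<alpha>) p) (omap (S \<alpha>) (ob W)) (omap (T \<alpha>) (ob W))
            (str W \<alpha>) (mmap (S \<alpha>) p (ob W) u) \<in> Hom M (omap (S \<alpha>) p) (omap (T \<alpha>) (ob W))"
          by (rule category_comp[OF M Sp SW TW Su strW])
        fix a assume a: "a \<in> Obj D"
        note Sa = functor_obj[OF S oF[OF a]] and Ta = functor_obj[OF T oF[OF a]]
          and S\<zeta> = functor_hom[OF S oF[OF a] p \<zeta>[OF a]]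
          and T\<zeta> = functor_hom[OF T oF[OF a] p \<zeta>[OF a]]
          and stra = str_hom[OF Fo[OF a] \<alpha>]
        show "Comp M (omap (fct_comp (S \<alpha>) (fct_comp U F)) a) (omap (S \<alpha>) p) (omap (T \<alpha>) (ob W))
            (Comp M (omap (S \<alpha>) p) (omap (T \<alpha>) p) (omap (T \<alpha>) (ob W))
              (mmap (T \<alpha>) p (ob W) u) (\<tau> \<alpha>)) (mmap (S \<alpha>) (ob (omap F a)) p (\<zeta> a)) =
          Comp M (omap (fct_comp (S \<alpha>) (fct_comp U F)) a) (omap (S \<alpha>) p) (omap (T \<alpha>) (ob W))
            (Comp M (omap (S \<alpha>) p) (omap (S \<alpha>) (ob W)) (omap (T \<alpha>) (ob W))
              (str W \<alpha>) (mmap (S \<alpha>) p (ob W) u)) (mmap (S \<alpha>) (ob (omap F a)) p (\<zeta> a))"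
          unfolding fct_comp_omap U_simps
            category_assoc[OF M Sa Sp Tp TW S\<zeta> \<tau>\<alpha> Tu, symmetric] \<tau>\<zeta>[OF \<alpha> a]
            category_assoc[OF M Sa Ta Tp TW stra T\<zeta> Tu]
            functor_comp[OF T oF[OF a] p oW \<zeta>[OF a] u, symmetric]
            category_assoc[OF M Sa Sp SW TW S\<zeta> Su strW, symmetric]
            functor_comp[OF S oF[OF a] p oW \<zeta>[OF a] u, symmetric] u\<zeta>[OF a]
          by (rule Hom_commutes[OF Fo[OF a] W \<xi>[OF a] \<alpha>])
      qed
    qed
    show "\<exists>!u. u \<in> Hom C V W \<and> (\<forall>a\<in>Obj D. Comp C (omap F a) V W u (\<zeta> a) = \<xi> a)"
    proof (rule ex1I[of _ u], intro conjI ballI)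
      show "u \<in> Hom C V W" by (rule uC)
      show "Comp C (omap F a) V W u (\<zeta> a) = \<xi> a" if a: "a \<in> Obj D" for a
        using u\<zeta>[OF a] by (simp add: Comp_eq[OF Fo[OF a] V W] oV)
    next
      fix v assume v: "v \<in> Hom C V W \<and> (\<forall>a\<in>Obj D. Comp C (omap F a) V W v (\<zeta> a) = \<xi> a)"
      show "v = u"
      proof (rule colimit_legs_jointly_epic[OF UF colim oW _ u])
        show "v \<in> Hom P p (ob W)" using Hom_base[OF V W] v oV by auto
        fix a assume a: "a \<in> Obj D"
        show "Comp P (omap (fct_comp U F) a) p (ob W) v (\<zeta> a) =
            Comp P (omap (fct_comp U F) a) p (ob W) u (\<zeta> a)"
          using bspec[OF conjunct2[OF v] a] u\<zeta>[OF a] by (simp add: Comp_eq[OF Fo[OF a] V W] oV)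
      qed
    qed
  qed
  then show thesis using V oV that by blast
qed

end


section \<open>Small sets\<close>

lemma small_image: "small TYPE('u) A \<Longrightarrow> small TYPE('u) (f ` A)"
  unfolding small_def by (rule ordLeq_ordLess_trans[OF card_of_image])

text \<open>
  The number of elements of \<open>'u\<close> is an infinite regular cardinal, hence it cannot be reached by a
  union of fewer sets each of which has fewer elements.
\<close>

lemma small_UN:
  assumes "universe TYPE('u)" and "small TYPE('u) I" and "\<And>i. i \<in> I \<Longrightarrow> small TYPE('u) (A i)"
  shows "small TYPE('u) (\<Union>i\<in>I. A i)"
proof -
  have "infinite (UNIV :: 'u set)"
    using assms(1) unfolding universe_def small_def
    by (meson infinite_iff_card_of_nat ordLess_imp_ordLeq)
  then have "stable |UNIV :: 'u set|"
    using assms(1) unfolding universe_def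
    by (intro regularCard_stable card_of_Card_order) (simp_all add: Field_card_of)
  then show ?thesis
    using assms(2,3) card_of_UNION_ordLess_infinite unfolding small_def by blast
qed

lemma small_SIGMA:
  assumes "universe TYPE('u)" and "small TYPE('u) I" and "\<And>i. i \<in> I \<Longrightarrow> small TYPE('u) (A i)"
  shows "small TYPE('u) (SIGMA i:I. A i)"
proof -
  have eq: "(SIGMA i:I. A i) = (\<Union>i\<in>I. Pair i ` A i)" by auto
  show ?thesis unfolding eq by (intro small_UN small_image assms)
qed

text \<open>
  The lists of one fixed length form an iterated product of small sets, and there are only \<open>\<nat>\<close> many
  lengths. This uses that \<open>\<nat>\<close> is small, so that \<open>'u\<close> is uncountable.
\<close>

lemma small_lists:
  assumes univ: "universe TYPE('u)" and A: "small TYPE('u) A"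
  shows "small TYPE('u) (lists A)"
proof -
  have "small TYPE('u) {w \<in> lists A. length w = n}" for n
  proof (induction n)
    case 0
    have eq: "{w \<in> lists A. length w = 0} = (\<lambda>n. []) ` (UNIV :: nat set)" by auto
    show ?case unfolding eq using univ unfolding universe_def by (intro small_image) blast
  next
    case (Suc n)
    have "{w \<in> lists A. length w = Suc n} =
        (\<lambda>(x, w). x # w) ` (SIGMA x:A. {w \<in> lists A. length w = n})"
      by (auto simp: length_Suc_conv image_iff)
    then show ?case using small_image[OF small_SIGMA[OF univ A Suc]] by simp
  qed
  then have "small TYPE('u) (\<Union>n :: nat. {w \<in> lists A. length w = n})"
    using univ by (intro small_UN) (simp_all add: universe_def)
  moreover have "(\<Union>n. {w \<in> lists A. length w = n}) = lists A" by auto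
  ultimately show ?thesis by (simp only:)
qed

lemma small_encoding:
  fixes A :: "'x set"
  assumes "small TYPE('u) A"
  obtains h :: "'x \<Rightarrow> 'u" where "inj_on h A"
proof -
  have "|A| \<le>o |UNIV :: 'u set|"
    using assms unfolding small_def by (rule ordLess_imp_ordLeq)
  then have "\<exists>h :: 'x \<Rightarrow> 'u. inj_on h A \<and> h ` A \<subseteq> UNIV"
    by (simp only: card_of_ordLeq)
  then show thesis using that by blast
qed


section \<open>Colimits of modules\<close>

definition mod_cat :: "('k, 'r) ring_scheme \<Rightarrow> (('k, 'u) module, 'u \<Rightarrow> 'u) cat" where
  "mod_cat k =
     \<lparr> Obj = {V. module k V \<and> small TYPE('u) (carrier V)},
       Hom = lin_maps k,
       Ident = (\<lambda>V. \<lambda>x\<in>carrier V. x),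
       Comp = (\<lambda>L M N g f. compose (carrier L) g f) \<rparr>"

lemma mod_cat_simps [simp]:
  "(V :: ('k, 'u) module) \<in> Obj (mod_cat k) \<longleftrightarrow> module k V \<and> small TYPE('u) (carrier V)"
  "Hom (mod_cat k) V W = lin_maps k V W"
  "Ident (mod_cat k) V = (\<lambda>x\<in>carrier V. x)"
  "Comp (mod_cat k) V W Z g f = compose (carrier V) g f"
  by (simp_all add: mod_cat_def)

lemma lin_maps_PiE: "f \<in> lin_maps k V W \<Longrightarrow> f \<in> carrier V \<rightarrow>\<^sub>E carrier W"
  and lin_maps_closed: "f \<in> lin_maps k V W \<Longrightarrow> x \<in> carrier V \<Longrightarrow> f x \<in> carrier W"
  and lin_maps_add: "f \<in> lin_maps k V W \<Longrightarrow> x \<in> carrier V \<Longrightarrow> y \<in> carrier V \<Longrightarrow>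
    f (x \<oplus>\<^bsub>V\<^esub> y) = f x \<oplus>\<^bsub>W\<^esub> f y"
  and lin_maps_smult: "f \<in> lin_maps k V W \<Longrightarrow> a \<in> carrier k \<Longrightarrow> x \<in> carrier V \<Longrightarrow>
    f (a \<odot>\<^bsub>V\<^esub> x) = a \<odot>\<^bsub>W\<^esub> f x"
  unfolding lin_maps_def by auto

lemma lin_maps_zero:
  assumes V: "module k V" and W: "module k W" and f: "f \<in> lin_maps k V W"
  shows "f \<zero>\<^bsub>V\<^esub> = \<zero>\<^bsub>W\<^esub>"
proof -
  interpret V: module k V by fact
  interpret W: module k W by fact
  have "f (\<zero>\<^bsub>k\<^esub> \<odot>\<^bsub>V\<^esub> \<zero>\<^bsub>V\<^esub>) = \<zero>\<^bsub>k\<^esub> \<odot>\<^bsub>W\<^esub> f \<zero>\<^bsub>V\<^esub>"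
    by (rule lin_maps_smult[OF f]) auto
  then show ?thesis using lin_maps_closed[OF f V.M.zero_closed] by simp
qed

lemma compose_eq_iff:
  "compose A g f = compose A g' f' \<longleftrightarrow> (\<forall>x\<in>A. g (f x) = g' (f' x))"
  by (auto simp: compose_def restrict_def fun_eq_iff)

lemma compose_lin_maps:
  assumes V: "module k V" and f: "f \<in> lin_maps k V W" and g: "g \<in> lin_maps k W Z"
  shows "compose (carrier V) g f \<in> lin_maps k V Z"
proof -
  interpret V: module k V by fact
  have "compose (carrier V) g f \<in> carrier V \<rightarrow>\<^sub>E carrier Z"
    using lin_maps_closed[OF f] lin_maps_closed[OF g] by (auto simp: compose_def)
  then show ?thesis
    using lin_maps_closed[OF f] f g
    by (auto simp: lin_maps_def compose_eq)
qed

lemma mod_cat_category: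
  fixes k :: "('k, 'r) ring_scheme"
  shows "is_category (mod_cat k :: (('k, 'u) module, 'u \<Rightarrow> 'u) cat)"
  unfolding is_category_def mod_cat_simps
proof (intro conjI ballI)
  fix V :: "('k, 'u) module" assume "V \<in> Obj (mod_cat k)"
  then interpret V: module k V by simp
  show "(\<lambda>x\<in>carrier V. x) \<in> lin_maps k V V" by (auto simp: lin_maps_def)
  {
    fix W f assume f: "f \<in> lin_maps k V W"
    show "compose (carrier V) f (\<lambda>x\<in>carrier V. x) = f"
      using lin_maps_PiE[OF f] by (auto simp: compose_def PiE_def extensional_def fun_eq_iff)
    show "compose (carrier V) (\<lambda>x\<in>carrier W. x) f = f"
      using lin_maps_PiE[OF f] by (auto simp: compose_def PiE_def extensional_def fun_eq_iff)
  }
  fix W Z f g assume f: "f \<in> lin_maps k V W" and g: "g \<in> lin_maps k W Z"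
  show "compose (carrier V) g f \<in> lin_maps k V Z"
    by (rule compose_lin_maps[OF V.module_axioms f g])
  fix h :: "'u \<Rightarrow> 'u"
  show "compose (carrier V) h (compose (carrier V) g f) =
      compose (carrier V) (compose (carrier W) h g) f"
    using lin_maps_closed[OF f] by (auto simp: compose_def)
qed

text \<open>
  Every element of a colimit of modules is a finite sum of elements of the modules of the diagram,
  that is, of images under the legs. Such a sum is written as a word, whose letter \<open>(d, x)\<close> stands for
  the element \<open>x\<close> of the module at \<open>d\<close>. In the vertex of any other cocone \<open>g\<close> the word has the value
  below.
\<close>

fun word_sum :: "('k, 'u) module \<Rightarrow> ('d \<Rightarrow> 'u \<Rightarrow> 'u) \<Rightarrow> ('d \<times> 'u) list \<Rightarrow> 'u" where
  "word_sum N g [] = \<zero>\<^bsub>N\<^esub>"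
| "word_sum N g ((d, x) # w) = g d x \<oplus>\<^bsub>N\<^esub> word_sum N g w"

text \<open>
  In a colimit two words represent the same element if and only if they have the same value in every
  cocone: the values factor through the colimit, and the colimit is itself a cocone. The colimit is
  therefore constructed as the set of words modulo this relation. A word modulo the relation determines
  its value in each cocone, which gives the factorizations; and since identities between words are
  tested in modules, the quotient satisfies the module axioms because every module does. The words form
  a small set, so the quotient can be realized inside \<open>'u\<close>.
\<close>

locale module_diagram =
  fixes k :: "('k, 'r) ring_scheme" and D :: "('d, 'e) cat"
    and F :: "('d, 'e, ('k, 'u) module, 'u \<Rightarrow> 'u) fct"
  assumes univ: "universe TYPE('u)"
    and cring: "cring k"
    and small_shape: "small TYPE('u) (Obj D)"
    and F: "is_functor D (mod_cat k) F"
begin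

definition words :: "('d \<times> 'u) list set" where
  "words = lists (SIGMA d:Obj D. carrier (omap F d))"

definition smult_word :: "'k \<Rightarrow> ('d \<times> 'u) list \<Rightarrow> ('d \<times> 'u) list" where
  "smult_word a = map (\<lambda>(d, x). (d, a \<odot>\<^bsub>omap F d\<^esub> x))"

abbreviation cocone :: "('k, 'u) module \<Rightarrow> ('d \<Rightarrow> 'u \<Rightarrow> 'u) \<Rightarrow> bool" where
  "cocone N g \<equiv> is_cocone D (mod_cat k) F N g"

lemma module_F: "d \<in> Obj D \<Longrightarrow> module k (omap F d)"
  using functor_obj[OF F] by simp

lemma small_words: "small TYPE('u) words"
  unfolding words_def
  by (rule small_lists[OF univ small_SIGMA[OF univ small_shape]]) (use functor_obj[OF F] in simp)

lemma cocone_module: "cocone N g \<Longrightarrow> module k N"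
  using cocone_obj by fastforce

lemma cocone_lin: "cocone N g \<Longrightarrow> d \<in> Obj D \<Longrightarrow> g d \<in> lin_maps k (omap F d) N"
  using cocone_leg by fastforce

lemma words_Nil: "[] \<in> words"
  and words_Cons: "(d, x) # w \<in> words \<longleftrightarrow> d \<in> Obj D \<and> x \<in> carrier (omap F d) \<and> w \<in> words"
  and words_append: "v \<in> words \<Longrightarrow> w \<in> words \<Longrightarrow> v @ w \<in> words"
  unfolding words_def by auto

lemma words_smult: "a \<in> carrier k \<Longrightarrow> w \<in> words \<Longrightarrow> smult_word a w \<in> words"
  using module.smult_closed[OF module_F]
  unfolding words_def smult_word_def by (induction w) auto

lemma word_sum_closed: "cocone N g \<Longrightarrow> w \<in> words \<Longrightarrow> word_sum N g w \<in> carrier N"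
proof (induction w)
  case Nil
  interpret module k N by (rule cocone_module[OF Nil(1)])
  show ?case by simp
next
  case (Cons p w)
  interpret module k N by (rule cocone_module[OF Cons(2)])
  show ?case using Cons lin_maps_closed[OF cocone_lin[OF Cons(2)]]
    by (cases p) (auto simp: words_Cons)
qed

lemma word_sum_append:
  assumes co: "cocone N g" and v: "v \<in> words" and w: "w \<in> words"
  shows "word_sum N g (v @ w) = word_sum N g v \<oplus>\<^bsub>N\<^esub> word_sum N g w"
proof -
  interpret module k N by (rule cocone_module[OF co])
  note w_closed = word_sum_closed[OF co w]
  show ?thesis using v
  proof (induction v)
    case Nil
    show ?case using w_closed by simp
  next
    case (Cons p v)
    then show ?case
      using lin_maps_closed[OF cocone_lin[OF co]] word_sum_closed[OF co] w_closed
      by (cases p) (auto simp: words_Cons M.a_assoc)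
  qed
qed

lemma word_sum_smult:
  assumes co: "cocone N g" and a: "a \<in> carrier k" and w: "w \<in> words"
  shows "word_sum N g (smult_word a w) = a \<odot>\<^bsub>N\<^esub> word_sum N g w"
proof -
  interpret module k N by (rule cocone_module[OF co])
  show ?thesis using w
  proof (induction w)
    case Nil
    show ?case using a by (simp add: smult_word_def)
  next
    case (Cons p w)
    then show ?case
      using lin_maps_closed[OF cocone_lin[OF co]] word_sum_closed[OF co] a
        lin_maps_smult[OF cocone_lin[OF co] a]
      by (cases p) (auto simp: words_Cons smult_word_def smult_r_distr)
  qed
qed

definition cls :: "('d \<times> 'u) list \<Rightarrow> ('d \<times> 'u) list set" where
  "cls w = {v \<in> words. \<forall>N g. cocone N g \<longrightarrow> word_sum N g v = word_sum N g w}"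

text \<open>
  The class of a word is encoded by an element of \<open>'u\<close>, because the carrier of the colimit has to be a
  subset of \<open>'u\<close>.
\<close>

definition enc :: "('d \<times> 'u) list set \<Rightarrow> 'u" where
  "enc = (SOME h. inj_on h (cls ` words))"

definition formal_sum :: "('d \<times> 'u) list \<Rightarrow> 'u" where
  "formal_sum w = enc (cls w)"

lemma enc_inj: "inj_on enc (cls ` words)"
proof -
  obtain h :: "('d \<times> 'u) list set \<Rightarrow> 'u" where "inj_on h (cls ` words)"
    by (rule small_encoding[OF small_image[OF small_words]])
  then show ?thesis unfolding enc_def by (rule someI[where P = "\<lambda>h. inj_on h (cls ` words)"])
qed

lemma formal_sum_eqI:
  assumes "\<And>N g. cocone N g \<Longrightarrow> word_sum N g v = word_sum N g w"
  shows "formal_sum v = formal_sum w"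
  using assms by (simp add: formal_sum_def cls_def cong: conj_cong)

lemma formal_sum_eqD:
  assumes eq: "formal_sum v = formal_sum w" and v: "v \<in> words" and w: "w \<in> words"
    and co: "cocone N g"
  shows "word_sum N g v = word_sum N g w"
proof -
  have "cls v = cls w" using inj_onD[OF enc_inj eq[unfolded formal_sum_def]] v w by simp
  then have "v \<in> cls w" using v unfolding cls_def by blast
  then show ?thesis using co unfolding cls_def by blast
qed

definition word_of :: "'u \<Rightarrow> ('d \<times> 'u) list" where
  "word_of = inv_into words formal_sum"

lemma word_of_words: "x \<in> formal_sum ` words \<Longrightarrow> word_of x \<in> words"
  unfolding word_of_def by (rule inv_into_into)

lemma formal_sum_word_of: "x \<in> formal_sum ` words \<Longrightarrow> formal_sum (word_of x) = x"
  unfolding word_of_def by (rule f_inv_into_f)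

text \<open>
  The operations are those of words, transported along chosen representatives. The fields \<open>mult\<close> and
  \<open>one\<close> of the record belong to the ring structure that a module does not have.
\<close>

definition L :: "('k, 'u) module" where
  "L = \<lparr> carrier = formal_sum ` words, monoid.mult = undefined, one = undefined, zero = formal_sum [],
     add = (\<lambda>x y. formal_sum (word_of x @ word_of y)),
     smult = (\<lambda>a x. formal_sum (smult_word a (word_of x))) \<rparr>"

definition val :: "('k, 'u) module \<Rightarrow> ('d \<Rightarrow> 'u \<Rightarrow> 'u) \<Rightarrow> 'u \<Rightarrow> 'u" where
  "val N g = (\<lambda>x\<in>carrier L. word_sum N g (word_of x))"

definition leg :: "'d \<Rightarrow> 'u \<Rightarrow> 'u" where
  "leg d = (\<lambda>x\<in>carrier (omap F d). formal_sum [(d, x)])"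

lemma carrier_L: "carrier L = formal_sum ` words"
  by (simp add: L_def)

lemma L_closed:
  "\<zero>\<^bsub>L\<^esub> \<in> carrier L"
  "x \<in> carrier L \<Longrightarrow> y \<in> carrier L \<Longrightarrow> x \<oplus>\<^bsub>L\<^esub> y \<in> carrier L"
  "a \<in> carrier k \<Longrightarrow> x \<in> carrier L \<Longrightarrow> a \<odot>\<^bsub>L\<^esub> x \<in> carrier L"
  by (auto simp: L_def intro!: imageI words_Nil words_append words_smult word_of_words)

lemma leg_closed: "d \<in> Obj D \<Longrightarrow> x \<in> carrier (omap F d) \<Longrightarrow> leg d x \<in> carrier L"
  by (auto simp: leg_def carrier_L words_Cons words_Nil)

lemma val_formal_sum:
  assumes "cocone N g" and "w \<in> words"
  shows "val N g (formal_sum w) = word_sum N g w"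
proof -
  have sw: "formal_sum w \<in> formal_sum ` words" using assms(2) by simp
  show ?thesis
    using formal_sum_eqD[OF formal_sum_word_of[OF sw] word_of_words[OF sw] assms(2,1)] sw
    by (simp add: val_def carrier_L)
qed

lemma val_closed: "cocone N g \<Longrightarrow> x \<in> carrier L \<Longrightarrow> val N g x \<in> carrier N"
  by (auto simp: carrier_L val_formal_sum word_sum_closed)

lemma val_zero: "cocone N g \<Longrightarrow> val N g \<zero>\<^bsub>L\<^esub> = \<zero>\<^bsub>N\<^esub>"
  using val_formal_sum[OF _ words_Nil] by (simp add: L_def)

lemma val_add:
  assumes "cocone N g" and "x \<in> carrier L" and "y \<in> carrier L"
  shows "val N g (x \<oplus>\<^bsub>L\<^esub> y) = val N g x \<oplus>\<^bsub>N\<^esub> val N g y"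
proof -
  have "x \<oplus>\<^bsub>L\<^esub> y = formal_sum (word_of x @ word_of y)" by (simp add: L_def)
  then show ?thesis
    using assms word_of_words[of x] word_of_words[of y]
    by (simp add: val_formal_sum words_append word_sum_append carrier_L) (simp add: val_def carrier_L)
qed

lemma val_smult:
  assumes "cocone N g" and "a \<in> carrier k" and "x \<in> carrier L"
  shows "val N g (a \<odot>\<^bsub>L\<^esub> x) = a \<odot>\<^bsub>N\<^esub> val N g x"
proof -
  have "a \<odot>\<^bsub>L\<^esub> x = formal_sum (smult_word a (word_of x))" by (simp add: L_def)
  then show ?thesis
    using assms word_of_words[of x]
    by (simp add: val_formal_sum words_smult word_sum_smult carrier_L) (simp add: val_def carrier_L)
qed

lemma val_leg:
  assumes co: "cocone N g" and d: "d \<in> Obj D" and x: "x \<in> carrier (omap F d)"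
  shows "val N g (leg d x) = g d x"
proof -
  interpret module k N by (rule cocone_module[OF co])
  show ?thesis
    using d x lin_maps_closed[OF cocone_lin[OF co d] x]
    by (simp add: leg_def val_formal_sum[OF co] words_Cons words_Nil)
qed

text \<open>
  All equations in \<open>L\<close> are proved through this criterion: the values \<open>val N g\<close> are homomorphisms, so
  an equation between elements of \<open>L\<close> reduces to the same equation in the modules \<open>N\<close>.
\<close>

lemma val_separates:
  assumes "x \<in> carrier L" and "y \<in> carrier L" and "\<And>N g. cocone N g \<Longrightarrow> val N g x = val N g y"
  shows "x = y"
  using assms by (auto simp: carrier_L val_formal_sum intro: formal_sum_eqI)

lemma L_module: "module k L"
proof -
  interpret cring k by (rule cring)
  show ?thesis
  proof (intro moduleI abelian_groupI cring)
    fix x y z assume [simp]: "x \<in> carrier L" "y \<in> carrier L" "z \<in> carrier L"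
    show "(x \<oplus>\<^bsub>L\<^esub> y) \<oplus>\<^bsub>L\<^esub> z = x \<oplus>\<^bsub>L\<^esub> (y \<oplus>\<^bsub>L\<^esub> z)"
    proof (rule val_separates)
      fix N g assume co: "cocone N g"
      interpret N: module k N by (rule cocone_module[OF co])
      show "val N g ((x \<oplus>\<^bsub>L\<^esub> y) \<oplus>\<^bsub>L\<^esub> z) = val N g (x \<oplus>\<^bsub>L\<^esub> (y \<oplus>\<^bsub>L\<^esub> z))"
        by (simp add: val_add[OF co] val_closed[OF co] L_closed N.M.a_assoc)
    qed (simp_all add: L_closed)
  next
    fix x y assume [simp]: "x \<in> carrier L" "y \<in> carrier L"
    show "x \<oplus>\<^bsub>L\<^esub> y = y \<oplus>\<^bsub>L\<^esub> x"
    proof (rule val_separates)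
      fix N g assume co: "cocone N g"
      interpret N: module k N by (rule cocone_module[OF co])
      show "val N g (x \<oplus>\<^bsub>L\<^esub> y) = val N g (y \<oplus>\<^bsub>L\<^esub> x)"
        by (simp add: val_add[OF co] val_closed[OF co] N.M.a_comm)
    qed (simp_all add: L_closed)
  next
    fix x assume [simp]: "x \<in> carrier L"
    show "\<zero>\<^bsub>L\<^esub> \<oplus>\<^bsub>L\<^esub> x = x"
    proof (rule val_separates)
      fix N g assume co: "cocone N g"
      interpret N: module k N by (rule cocone_module[OF co])
      show "val N g (\<zero>\<^bsub>L\<^esub> \<oplus>\<^bsub>L\<^esub> x) = val N g x"
        by (simp add: val_add[OF co] val_zero[OF co] val_closed[OF co] L_closed)
    qed (simp_all add: L_closed)
    show "\<one>\<^bsub>k\<^esub> \<odot>\<^bsub>L\<^esub> x = x"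
    proof (rule val_separates)
      fix N g assume co: "cocone N g"
      interpret N: module k N by (rule cocone_module[OF co])
      show "val N g (\<one>\<^bsub>k\<^esub> \<odot>\<^bsub>L\<^esub> x) = val N g x"
        by (simp add: val_smult[OF co] val_closed[OF co])
    qed (simp_all add: L_closed)
    show "\<exists>y\<in>carrier L. y \<oplus>\<^bsub>L\<^esub> x = \<zero>\<^bsub>L\<^esub>"
    \<comment> \<open>There is no operation of negation on words; negatives come from scalars.\<close>
    proof (rule bexI[of _ "(\<ominus>\<^bsub>k\<^esub> \<one>\<^bsub>k\<^esub>) \<odot>\<^bsub>L\<^esub> x"], rule val_separates)
      fix N g assume co: "cocone N g"
      interpret N: module k N by (rule cocone_module[OF co])
      show "val N g ((\<ominus>\<^bsub>k\<^esub> \<one>\<^bsub>k\<^esub>) \<odot>\<^bsub>L\<^esub> x \<oplus>\<^bsub>L\<^esub> x) = val N g \<zero>\<^bsub>L\<^esub>"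
        by (simp add: val_add[OF co] val_smult[OF co] val_zero[OF co] val_closed[OF co] L_closed
            N.smult_l_minus N.M.l_neg)
    qed (simp_all add: L_closed)
  next
    fix a x y assume [simp]: "a \<in> carrier k" "x \<in> carrier L" "y \<in> carrier L"
    show "a \<odot>\<^bsub>L\<^esub> (x \<oplus>\<^bsub>L\<^esub> y) = a \<odot>\<^bsub>L\<^esub> x \<oplus>\<^bsub>L\<^esub> a \<odot>\<^bsub>L\<^esub> y"
    proof (rule val_separates)
      fix N g assume co: "cocone N g"
      interpret N: module k N by (rule cocone_module[OF co])
      show "val N g (a \<odot>\<^bsub>L\<^esub> (x \<oplus>\<^bsub>L\<^esub> y)) = val N g (a \<odot>\<^bsub>L\<^esub> x \<oplus>\<^bsub>L\<^esub> a \<odot>\<^bsub>L\<^esub> y)"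
        by (simp add: val_add[OF co] val_smult[OF co] val_closed[OF co] L_closed N.smult_r_distr)
    qed (simp_all add: L_closed)
  next
    fix a b x assume [simp]: "a \<in> carrier k" "b \<in> carrier k" "x \<in> carrier L"
    show "(a \<oplus>\<^bsub>k\<^esub> b) \<odot>\<^bsub>L\<^esub> x = a \<odot>\<^bsub>L\<^esub> x \<oplus>\<^bsub>L\<^esub> b \<odot>\<^bsub>L\<^esub> x"
    proof (rule val_separates)
      fix N g assume co: "cocone N g"
      interpret N: module k N by (rule cocone_module[OF co])
      show "val N g ((a \<oplus>\<^bsub>k\<^esub> b) \<odot>\<^bsub>L\<^esub> x) = val N g (a \<odot>\<^bsub>L\<^esub> x \<oplus>\<^bsub>L\<^esub> b \<odot>\<^bsub>L\<^esub> x)"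
        by (simp add: val_add[OF co] val_smult[OF co] val_closed[OF co] L_closed N.smult_l_distr)
    qed (simp_all add: L_closed)
    show "(a \<otimes>\<^bsub>k\<^esub> b) \<odot>\<^bsub>L\<^esub> x = a \<odot>\<^bsub>L\<^esub> (b \<odot>\<^bsub>L\<^esub> x)"
    proof (rule val_separates)
      fix N g assume co: "cocone N g"
      interpret N: module k N by (rule cocone_module[OF co])
      show "val N g ((a \<otimes>\<^bsub>k\<^esub> b) \<odot>\<^bsub>L\<^esub> x) = val N g (a \<odot>\<^bsub>L\<^esub> (b \<odot>\<^bsub>L\<^esub> x))"
        by (simp add: val_smult[OF co] val_closed[OF co] L_closed N.smult_assoc1)
    qed (simp_all add: L_closed)
  qed (simp_all add: L_closed)
qed

lemma leg_lin:
  assumes d: "d \<in> Obj D"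
  shows "leg d \<in> lin_maps k (omap F d) L"
proof -
  interpret V: module k "omap F d" by (rule module_F[OF d])
  have "leg d (x \<oplus>\<^bsub>omap F d\<^esub> y) = leg d x \<oplus>\<^bsub>L\<^esub> leg d y"
    if x: "x \<in> carrier (omap F d)" and y: "y \<in> carrier (omap F d)" for x y
  proof (rule val_separates)
    fix N g assume co: "cocone N g"
    show "val N g (leg d (x \<oplus>\<^bsub>omap F d\<^esub> y)) = val N g (leg d x \<oplus>\<^bsub>L\<^esub> leg d y)"
      using d x y lin_maps_add[OF cocone_lin[OF co d] x y]
      by (simp add: val_add[OF co] val_leg[OF co] leg_closed)
  qed (use d x y in \<open>simp_all add: leg_closed L_closed\<close>)
  moreover have "leg d (a \<odot>\<^bsub>omap F d\<^esub> x) = a \<odot>\<^bsub>L\<^esub> leg d x"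
    if a: "a \<in> carrier k" and x: "x \<in> carrier (omap F d)" for a x
  proof (rule val_separates)
    fix N g assume co: "cocone N g"
    show "val N g (leg d (a \<odot>\<^bsub>omap F d\<^esub> x)) = val N g (a \<odot>\<^bsub>L\<^esub> leg d x)"
      using d a x lin_maps_smult[OF cocone_lin[OF co d] a x]
      by (simp add: val_smult[OF co] val_leg[OF co] leg_closed)
  qed (use d a x in \<open>simp_all add: leg_closed L_closed\<close>)
  ultimately show ?thesis
    using leg_closed[OF d] by (auto simp: lin_maps_def leg_def)
qed

lemma leg_cocone: "cocone L leg"
  unfolding is_cocone_def mod_cat_simps
proof (intro conjI ballI)
  show "module k L" by (rule L_module)
  show "small TYPE('u) (carrier L)" unfolding carrier_L by (rule small_image[OF small_words])
  fix a assume a: "a \<in> Obj D"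
  show "leg a \<in> lin_maps k (omap F a) L" by (rule leg_lin[OF a])
  fix b f assume b: "b \<in> Obj D" and f: "f \<in> Hom D a b"
  have Ff: "mmap F a b f \<in> lin_maps k (omap F a) (omap F b)"
    using functor_hom[OF F a b f] by simp
  show "compose (carrier (omap F a)) (leg b) (mmap F a b f) = leg a"
  proof (rule extensionalityI[of _ "carrier (omap F a)"])
    fix x assume x: "x \<in> carrier (omap F a)"
    have "leg b (mmap F a b f x) = leg a x"
    proof (rule val_separates)
      fix N g assume co: "cocone N g"
      have "g b (mmap F a b f x) = g a x"
        using fun_cong[OF cocone_comp[OF co a b f], of x] x by (simp add: compose_eq)
      then show "val N g (leg b (mmap F a b f x)) = val N g (leg a x)"
        by (simp add: val_leg[OF co] a b x lin_maps_closed[OF Ff x])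
    qed (simp_all add: leg_closed a b x lin_maps_closed[OF Ff x])
    then show "compose (carrier (omap F a)) (leg b) (mmap F a b f) x = leg a x"
      using x by (simp add: compose_eq)
  qed (simp_all add: leg_def)
qed

lemma val_lin: "cocone N g \<Longrightarrow> val N g \<in> lin_maps k L N"
  by (auto simp: lin_maps_def val_add val_smult val_closed) (auto simp: val_def)

text \<open>
  A linear map out of \<open>L\<close> is determined by its values on the legs, because a word is the sum of its
  letters.
\<close>

lemma val_unique:
  assumes co: "cocone N g" and u: "u \<in> lin_maps k L N"
    and eq: "\<And>d x. d \<in> Obj D \<Longrightarrow> x \<in> carrier (omap F d) \<Longrightarrow> u (leg d x) = g d x"
  shows "u = val N g"
proof (rule extensionalityI[of _ "carrier L"])
  show "u \<in> extensional (carrier L)" using lin_maps_PiE[OF u] by (simp add: PiE_def)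
  show "val N g \<in> extensional (carrier L)" by (simp add: val_def)
  have "u (formal_sum w) = word_sum N g w" if "w \<in> words" for w
    using that
  proof (induction w)
    case Nil
    show ?case
      using lin_maps_zero[OF L_module cocone_module[OF co] u] by (simp add: L_def)
  next
    case (Cons p w)
    obtain d x where p: "p = (d, x)" by (cases p)
    have d: "d \<in> Obj D" and x: "x \<in> carrier (omap F d)" and w: "w \<in> words"
      using Cons.prems unfolding p words_Cons by auto
    have sw: "formal_sum w \<in> carrier L" and lx: "leg d x \<in> carrier L"
      using w leg_closed[OF d x] by (auto simp: carrier_L)
    have "formal_sum (p # w) = leg d x \<oplus>\<^bsub>L\<^esub> formal_sum w"
    proof (rule val_separates)
      fix N' g' assume co': "cocone N' g'"
      show "val N' g' (formal_sum (p # w)) = val N' g' (leg d x \<oplus>\<^bsub>L\<^esub> formal_sum w)"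
        using val_formal_sum[OF co' Cons.prems] val_formal_sum[OF co' w] val_leg[OF co' d x]
        by (simp add: val_add[OF co' lx sw] p)
    qed (use Cons.prems L_closed(2)[OF lx sw] in \<open>auto simp: carrier_L\<close>)
    then show ?case
      using lin_maps_add[OF u lx sw] Cons.IH[OF w] eq[OF d x] p by simp
  qed
  then show "u x = val N g x" if "x \<in> carrier L" for x
    using that val_formal_sum[OF co] by (auto simp: carrier_L)
qed

lemma L_colimit: "is_colimit D (mod_cat k) F L leg"
  unfolding is_colimit_def
proof (intro conjI allI impI)
  show "cocone L leg" by (rule leg_cocone)
  fix N g assume co: "cocone N g"
  have factors_iff: "compose (carrier (omap F d)) u (leg d) = g d \<longleftrightarrow>
      (\<forall>x\<in>carrier (omap F d). u (leg d x) = g d x)" if d: "d \<in> Obj D" for u d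
  proof -
    have "g d \<in> extensional (carrier (omap F d))"
      using lin_maps_PiE[OF cocone_lin[OF co d]] by (simp add: PiE_def)
    then have "compose (carrier (omap F d)) u (leg d) = g d"
      if "\<forall>x\<in>carrier (omap F d). u (leg d x) = g d x"
      using that by (intro extensionalityI[of _ "carrier (omap F d)"]) (simp_all add: compose_eq)
    moreover have "u (leg d x) = g d x"
      if "compose (carrier (omap F d)) u (leg d) = g d" and "x \<in> carrier (omap F d)" for x
      using fun_cong[OF that(1), of x] that(2) by (simp add: compose_eq)
    ultimately show ?thesis by blast
  qed
  show "\<exists>!u. u \<in> Hom (mod_cat k) L N \<and>
      (\<forall>d\<in>Obj D. Comp (mod_cat k) (omap F d) L N u (leg d) = g d)"
    unfolding mod_cat_simps
  proof (rule ex1I[of _ "val N g"], intro conjI ballI)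
    show "val N g \<in> lin_maps k L N" by (rule val_lin[OF co])
    show "compose (carrier (omap F d)) (val N g) (leg d) = g d" if d: "d \<in> Obj D" for d
      unfolding factors_iff[OF d] using val_leg[OF co d] by blast
  next
    fix u assume u: "u \<in> lin_maps k L N \<and>
      (\<forall>d\<in>Obj D. compose (carrier (omap F d)) u (leg d) = g d)"
    show "u = val N g"
    proof (rule val_unique[OF co conjunct1[OF u]])
      fix d x assume d: "d \<in> Obj D" and x: "x \<in> carrier (omap F d)"
      show "u (leg d x) = g d x"
        using bspec[OF conjunct2[OF u] d] x unfolding factors_iff[OF d] by blast
    qed
  qed
qed

end

lemma mod_cat_cocomplete:
  fixes k :: "('k, 'r) ring_scheme"
  assumes "universe TYPE('u)" and "cring k"
  shows "cocomplete TYPE('u) (mod_cat k :: (('k, 'u) module, 'u \<Rightarrow> 'u) cat)"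
  unfolding cocomplete_def
proof (intro conjI allI impI mod_cat_category)
  fix D :: "('u, 'u) cat" and F :: "('u, 'u, ('k, 'u) module, 'u \<Rightarrow> 'u) fct"
  assume "small_category D \<and> is_functor D (mod_cat k) F"
  then interpret module_diagram k D F
    using assms by (intro module_diagram.intro) (auto simp: small_category_def)
  show "\<exists>L \<zeta>. is_colimit D (mod_cat k) F L \<zeta>" by (intro exI) (rule L_colimit)
qed


section \<open>Colimits of representations\<close>

lemma rep_cat_simps [simp]:
  "V \<in> Obj (rep_cat k Q) \<longleftrightarrow> is_rep k Q V"
  "Ident (rep_cat k Q) V = (\<lambda>i\<in>verts Q. \<lambda>x\<in>carrier (vsp V i). x)"
  "Comp (rep_cat k Q) V W Z g f = (\<lambda>i\<in>verts Q. compose (carrier (vsp V i)) (g i) (f i))"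
  by (simp_all add: rep_cat_def)

text \<open>
  The arrows of the quiver index the structure maps, which go from the module at the tail to the module
  at the head.
\<close>

lemma rep_cat_inserter:
  fixes k :: "('k, 'r) ring_scheme" and Q :: "('v, 'a) pre_digraph"
  assumes "wf_digraph Q"
  shows "inserter (rep_cat k Q :: (('v, 'a, 'k, 'u) rep, 'v \<Rightarrow> 'u \<Rightarrow> 'u) cat)
    (prod_cat (verts Q) (\<lambda>i. mod_cat k)) (mod_cat k)
    (arcs Q) (\<lambda>\<alpha>. proj_fct (tail Q \<alpha>)) (\<lambda>\<alpha>. proj_fct (head Q \<alpha>)) vsp vmap"
proof -
  interpret wf_digraph Q by fact
  show ?thesis
  proof
    show "is_category (prod_cat (verts Q) (\<lambda>i. mod_cat k :: (('k, 'u) module, 'u \<Rightarrow> 'u) cat))"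
      by (intro prod_cat_category mod_cat_category)
    fix \<alpha> assume "\<alpha> \<in> arcs Q"
    then show "is_functor (prod_cat (verts Q) (\<lambda>i. mod_cat k))
        (mod_cat k :: (('k, 'u) module, 'u \<Rightarrow> 'u) cat) (proj_fct (tail Q \<alpha>))"
      and "is_functor (prod_cat (verts Q) (\<lambda>i. mod_cat k))
        (mod_cat k :: (('k, 'u) module, 'u \<Rightarrow> 'u) cat) (proj_fct (head Q \<alpha>))"
      by (auto intro!: proj_functor[where C = "\<lambda>i. mod_cat k", simplified] mod_cat_category)
  next
    fix V :: "('v, 'a, 'k, 'u) rep" assume "V \<in> Obj (rep_cat k Q)"
    then have V: "is_rep k Q V" by simp
    show "vsp V \<in> Obj (prod_cat (verts Q) (\<lambda>i. mod_cat k))"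
      using V by (auto simp: is_rep_def PiE_iff)
    show "vmap V \<alpha> \<in> Hom (mod_cat k) (omap (proj_fct (tail Q \<alpha>)) (vsp V))
        (omap (proj_fct (head Q \<alpha>)) (vsp V))" if "\<alpha> \<in> arcs Q" for \<alpha>
      using V that by (auto simp: is_rep_def PiE_iff)
    fix W :: "('v, 'a, 'k, 'u) rep" and f
    show "f \<in> Hom (rep_cat k Q) V W \<longleftrightarrow>
      f \<in> Hom (prod_cat (verts Q) (\<lambda>i. mod_cat k)) (vsp V) (vsp W) \<and>
      (\<forall>\<alpha>\<in>arcs Q. Comp (mod_cat k) (omap (proj_fct (tail Q \<alpha>)) (vsp V))
          (omap (proj_fct (head Q \<alpha>)) (vsp V)) (omap (proj_fct (head Q \<alpha>)) (vsp W))
          (mmap (proj_fct (head Q \<alpha>)) (vsp V) (vsp W) f) (vmap V \<alpha>) =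
        Comp (mod_cat k) (omap (proj_fct (tail Q \<alpha>)) (vsp V))
          (omap (proj_fct (tail Q \<alpha>)) (vsp W)) (omap (proj_fct (head Q \<alpha>)) (vsp W))
          (vmap W \<alpha>) (mmap (proj_fct (tail Q \<alpha>)) (vsp V) (vsp W) f))"
      by (simp add: compose_eq_iff) (simp add: rep_cat_def)
    show "Ident (rep_cat k Q) V = Ident (prod_cat (verts Q) (\<lambda>i. mod_cat k)) (vsp V)" by simp
    show "Comp (rep_cat k Q) V W Z =
        Comp (prod_cat (verts Q) (\<lambda>i. mod_cat k)) (vsp V) (vsp W) (vsp Z)"
      for Z :: "('v, 'a, 'k, 'u) rep"
      by (simp add: fun_eq_iff)
  next
    fix p :: "'v \<Rightarrow> ('k, 'u) module" and \<tau>
    assume p: "p \<in> Obj (prod_cat (verts Q) (\<lambda>i. mod_cat k))"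
      and \<tau>: "\<And>\<alpha>. \<alpha> \<in> arcs Q \<Longrightarrow> \<tau> \<alpha> \<in> Hom (mod_cat k) (omap (proj_fct (tail Q \<alpha>)) p)
        (omap (proj_fct (head Q \<alpha>)) p)"
    show "\<exists>V\<in>Obj (rep_cat k Q). vsp V = p \<and> (\<forall>\<alpha>\<in>arcs Q. vmap V \<alpha> = \<tau> \<alpha>)"
    proof (rule bexI[of _ "\<lparr> vsp = p, vmap = restrict \<tau> (arcs Q) \<rparr>"])
      show "\<lparr> vsp = p, vmap = restrict \<tau> (arcs Q) \<rparr> \<in> Obj (rep_cat k Q)"
        using p \<tau> by (auto simp: is_rep_def PiE_iff)
    qed simp
  qed
qed

abbreviation eval_fct ::
  "'v \<Rightarrow> (('v, 'a, 'k, 'u) rep, 'v \<Rightarrow> 'u \<Rightarrow> 'u, ('k, 'u) module, 'u \<Rightarrow> 'u) fct" where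
  "eval_fct i \<equiv> \<lparr> omap = (\<lambda>V. vsp V i), mmap = (\<lambda>V W f. f i) \<rparr>"

lemma rep_cat_category: "wf_digraph Q \<Longrightarrow> is_category (rep_cat k Q)"
  by (rule inserter.category[OF rep_cat_inserter])

text \<open>
  The structure maps of a representation start at the modules of a product of copies of the category of
  modules, and projections preserve the componentwise colimits of a product. So these lift to
  representations.
\<close>

lemma rep_cat_pointwise_colimit:
  fixes k :: "('k, 'r) ring_scheme" and Q :: "('v, 'a) pre_digraph" and D :: "('u, 'u) cat"
    and F :: "('u, 'u, ('v, 'a, 'k, 'u) rep, 'v \<Rightarrow> 'u \<Rightarrow> 'u) fct"
  assumes univ: "universe TYPE('u)" and k: "cring k" and Q: "wf_digraph Q"
    and D: "small_category D" and F: "is_functor D (rep_cat k Q) F"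
  obtains V \<zeta> where "is_colimit D (rep_cat k Q) F V \<zeta>"
    and "\<And>i. i \<in> verts Q \<Longrightarrow>
      is_colimit D (mod_cat k) (fct_comp (eval_fct i) F) (vsp V i) (\<lambda>d. \<zeta> d i)"
proof -
  interpret inserter "rep_cat k Q :: (('v, 'a, 'k, 'u) rep, 'v \<Rightarrow> 'u \<Rightarrow> 'u) cat"
    "prod_cat (verts Q) (\<lambda>i. mod_cat k)" "mod_cat k"
    "arcs Q" "\<lambda>\<alpha>. proj_fct (tail Q \<alpha>)" "\<lambda>\<alpha>. proj_fct (head Q \<alpha>)" vsp vmap
    by (rule rep_cat_inserter[OF Q])
  interpret wf_digraph Q by (rule Q)
  note UF = functor_fct_comp[OF F U_functor]
  have eval: "fct_comp (proj_fct i) (fct_comp U F) = fct_comp (eval_fct i) F" for i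
    by (simp add: fct_comp_def)
  have proj: "is_functor (prod_cat (verts Q) (\<lambda>i. mod_cat k))
      (mod_cat k :: (('k, 'u) module, 'u \<Rightarrow> 'u) cat) (proj_fct i)" if "i \<in> verts Q" for i
    using proj_functor[where C = "\<lambda>i. mod_cat k", OF mod_cat_category that] .
  have "\<exists>L \<zeta>. is_colimit D (mod_cat k) (fct_comp (eval_fct i) F) L \<zeta>" if i: "i \<in> verts Q" for i
    using mod_cat_cocomplete[OF univ k] D functor_fct_comp[OF UF proj[OF i]]
    unfolding cocomplete_def eval by blast
  then obtain L \<zeta> where L: "\<And>i. i \<in> verts Q \<Longrightarrow>
      is_colimit D (mod_cat k) (fct_comp (eval_fct i) F) (L i) (\<zeta> i)"
    by metis
  have "is_colimit D (prod_cat (verts Q) (\<lambda>i. mod_cat k)) (fct_comp U F) (restrict L (verts Q))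
      (\<lambda>d. \<lambda>i\<in>verts Q. \<zeta> i d)"
    by (rule colimit_prod_cat[OF UF]) (simp add: eval L)
  then obtain V where V: "vsp V = restrict L (verts Q)"
    and colim: "is_colimit D (rep_cat k Q) F V (\<lambda>d. \<lambda>i\<in>verts Q. \<zeta> i d)"
    by (rule colimit_lifts[OF F]) (use eval L in auto)
  show thesis
    by (rule that[OF colim]) (use L V in simp)
qed

lemma eval_functor:
  fixes k :: "('k, 'r) ring_scheme" and Q :: "('v, 'a) pre_digraph"
  assumes Q: "wf_digraph Q" and i: "i \<in> verts Q"
  shows "is_functor (rep_cat k Q :: (('v, 'a, 'k, 'u) rep, 'v \<Rightarrow> 'u \<Rightarrow> 'u) cat)
    (mod_cat k) (eval_fct i)"
proof -
  interpret inserter "rep_cat k Q :: (('v, 'a, 'k, 'u) rep, 'v \<Rightarrow> 'u \<Rightarrow> 'u) cat"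
    "prod_cat (verts Q) (\<lambda>i. mod_cat k)" "mod_cat k"
    "arcs Q" "\<lambda>\<alpha>. proj_fct (tail Q \<alpha>)" "\<lambda>\<alpha>. proj_fct (head Q \<alpha>)" vsp vmap
    by (rule rep_cat_inserter[OF Q])
  have "eval_fct i = fct_comp (proj_fct i) U"
    by (simp add: fct_comp_def)
  then show ?thesis
    using functor_fct_comp[OF U_functor
        proj_functor[where C = "\<lambda>i. mod_cat k", OF mod_cat_category i]] by simp
qed

text \<open>
  This is what an unspecified colimit of representations has to satisfy in order that maps out of one of
  its modules can be defined on the modules of the diagram. It holds for the pointwise colimit, hence
  for all.
\<close>

lemma eval_preserves_colimit:
  fixes k :: "('k, 'r) ring_scheme" and Q :: "('v, 'a) pre_digraph" and D :: "('u, 'u) cat"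
    and F :: "('u, 'u, ('v, 'a, 'k, 'u) rep, 'v \<Rightarrow> 'u \<Rightarrow> 'u) fct"
  assumes univ: "universe TYPE('u)" and k: "cring k" and Q: "wf_digraph Q"
    and D: "small_category D" and F: "is_functor D (rep_cat k Q) F"
    and colim: "is_colimit D (rep_cat k Q) F V \<zeta>" and i: "i \<in> verts Q"
  shows "is_colimit D (mod_cat k) (fct_comp (eval_fct i) F) (vsp V i) (\<lambda>d. \<zeta> d i)"
proof -
  obtain W \<xi> where W: "is_colimit D (rep_cat k Q) F W \<xi>"
    and Wi: "is_colimit D (mod_cat k) (fct_comp (eval_fct i) F) (vsp W i) (\<lambda>d. \<xi> d i)"
    using rep_cat_pointwise_colimit[OF univ k Q D F] i by metis
  show ?thesis
    using preserves_colimit_if_preserves_one[OF eval_functor[OF Q i] F W _ colim] Wi by simp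
qed

lemma rep_cat_cocomplete:
  fixes k :: "('k, 'r) ring_scheme" and Q :: "('v, 'a) pre_digraph"
  assumes univ: "universe TYPE('u)" and k: "cring k" and Q: "wf_digraph Q"
  shows "cocomplete TYPE('u) (rep_cat k Q :: (('v, 'a, 'k, 'u) rep, 'v \<Rightarrow> 'u \<Rightarrow> 'u) cat)"
  unfolding cocomplete_def
  using rep_cat_category[OF Q] rep_cat_pointwise_colimit[OF univ k Q] by metis


section \<open>Colimits of n-representations\<close>

text \<open>
  The triple \<open>(m, \<gamma>, \<delta>)\<close> stands for the linear map from the module of the \<open>m\<close>-th representation at the
  head of \<open>\<gamma>\<close> to the module of the next representation at the tail of \<open>\<delta>\<close>. The functors
  \<open>link_source\<close> and \<open>link_target\<close> send a tuple of representations to the domain and the codomain.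
\<close>

definition link_indices :: "nat \<Rightarrow> (nat \<Rightarrow> ('v, 'a) pre_digraph) \<Rightarrow> (nat \<times> 'a \<times> 'a) set" where
  "link_indices n Q = (SIGMA m:{1..n-1}. arcs (Q m) \<times> arcs (Q (m+1)))"

definition link_source ::
  "(nat \<Rightarrow> ('v, 'a) pre_digraph) \<Rightarrow> nat \<times> 'a \<times> 'a \<Rightarrow>
    (nat \<Rightarrow> ('v, 'a, 'k, 'u) rep, nat \<Rightarrow> 'v \<Rightarrow> 'u \<Rightarrow> 'u, ('k, 'u) module, 'u \<Rightarrow> 'u) fct" where
  "link_source Q = (\<lambda>(m, \<gamma>, \<delta>). fct_comp (eval_fct (head (Q m) \<gamma>)) (proj_fct m))"

definition link_target ::
  "(nat \<Rightarrow> ('v, 'a) pre_digraph) \<Rightarrow> nat \<times> 'a \<times> 'a \<Rightarrow>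
    (nat \<Rightarrow> ('v, 'a, 'k, 'u) rep, nat \<Rightarrow> 'v \<Rightarrow> 'u \<Rightarrow> 'u, ('k, 'u) module, 'u \<Rightarrow> 'u) fct" where
  "link_target Q = (\<lambda>(m, \<gamma>, \<delta>). fct_comp (eval_fct (tail (Q (m+1)) \<delta>)) (proj_fct (m+1)))"

lemma link_fct_simps [simp]:
  "omap (link_source Q (m, \<gamma>, \<delta>)) p = vsp (p m) (head (Q m) \<gamma>)"
  "mmap (link_source Q (m, \<gamma>, \<delta>)) p p' f = f m (head (Q m) \<gamma>)"
  "omap (link_target Q (m, \<gamma>, \<delta>)) p = vsp (p (m+1)) (tail (Q (m+1)) \<delta>)"
  "mmap (link_target Q (m, \<gamma>, \<delta>)) p p' f = f (m+1) (tail (Q (m+1)) \<delta>)"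
  by (simp_all add: link_source_def link_target_def)

lemma nrep_cat_simps [simp]:
  "V \<in> Obj (nrep_cat k n Q) \<longleftrightarrow> is_nrep k n Q V"
  "Ident (nrep_cat k n Q) V = Ident (prod_rep_cat k n Q) (part V)"
  "Comp (nrep_cat k n Q) V W Z = Comp (prod_rep_cat k n Q) (part V) (part W) (part Z)"
  by (simp_all add: nrep_cat_def del: prod_cat_simps)

lemma nrep_cat_inserter:
  fixes k :: "('k, 'r) ring_scheme" and Q :: "nat \<Rightarrow> ('v, 'a) pre_digraph"
  assumes Q: "\<And>m. m \<in> {1..n} \<Longrightarrow> wf_digraph (Q m)"
  shows "inserter (nrep_cat k n Q :: (('v, 'a, 'k, 'u) nrep, nat \<Rightarrow> 'v \<Rightarrow> 'u \<Rightarrow> 'u) cat)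
    (prod_rep_cat k n Q) (mod_cat k)
    (link_indices n Q) (link_source Q) (link_target Q) part (\<lambda>V (m, \<gamma>, \<delta>). link V m \<gamma> \<delta>)"
    (is "inserter ?C ?P ?M _ _ _ _ ?str")
proof
  note prod_cat_simps [simp del]
  have category: "is_category (rep_cat k (Q m) :: (('v, 'a, 'k, 'u) rep, 'v \<Rightarrow> 'u \<Rightarrow> 'u) cat)"
    if "m \<in> {1..n}" for m
    by (rule rep_cat_category[OF Q[OF that]])
  show "is_category ?P" by (rule prod_cat_category[OF category])
  have proj: "is_functor ?P (rep_cat k (Q m)) (proj_fct m)" if "m \<in> {1..n}" for m
    using category that by (rule proj_functor)
  have eval: "is_functor ?P ?M (fct_comp (eval_fct i) (proj_fct m))"
    if m: "m \<in> {1..n}" and i: "i \<in> verts (Q m)" for m i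
    using functor_fct_comp[OF proj[OF m] eval_functor[OF Q[OF m] i]] .
  fix \<alpha> assume \<alpha>: "\<alpha> \<in> link_indices n Q"
  obtain m \<gamma> \<delta> where \<alpha>_eq: "\<alpha> = (m, \<gamma>, \<delta>)" by (cases \<alpha>)
  have m: "m \<in> {1..n}" and m': "m + 1 \<in> {1..n}" and \<gamma>: "\<gamma> \<in> arcs (Q m)"
    and \<delta>: "\<delta> \<in> arcs (Q (m+1))"
    using \<alpha> unfolding \<alpha>_eq link_indices_def by auto
  show "is_functor ?P ?M (link_source Q \<alpha>)" "is_functor ?P ?M (link_target Q \<alpha>)"
    using eval[OF m wf_digraph.head_in_verts[OF Q[OF m] \<gamma>]]
      eval[OF m' wf_digraph.tail_in_verts[OF Q[OF m'] \<delta>]]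
    by (simp_all add: \<alpha>_eq link_source_def link_target_def)
next
  fix V :: "('v, 'a, 'k, 'u) nrep" assume "V \<in> Obj ?C"
  then have V: "is_nrep k n Q V" by simp
  show "part V \<in> Obj ?P"
    using V by (auto simp: is_nrep_def PiE_iff prod_cat_simps)
  show "?str V \<alpha> \<in> Hom ?M (omap (link_source Q \<alpha>) (part V)) (omap (link_target Q \<alpha>) (part V))"
    if "\<alpha> \<in> link_indices n Q" for \<alpha>
    using V that by (auto simp: is_nrep_def PiE_iff link_indices_def)
  fix W :: "('v, 'a, 'k, 'u) nrep" and f
  show "f \<in> Hom ?C V W \<longleftrightarrow> f \<in> Hom ?P (part V) (part W) \<and>
    (\<forall>\<alpha>\<in>link_indices n Q.
      Comp ?M (omap (link_source Q \<alpha>) (part V)) (omap (link_target Q \<alpha>) (part V))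
        (omap (link_target Q \<alpha>) (part W)) (mmap (link_target Q \<alpha>) (part V) (part W) f) (?str V \<alpha>) =
      Comp ?M (omap (link_source Q \<alpha>) (part V)) (omap (link_source Q \<alpha>) (part W))
        (omap (link_target Q \<alpha>) (part W)) (?str W \<alpha>) (mmap (link_source Q \<alpha>) (part V) (part W) f))"
    by (auto simp: compose_eq_iff link_indices_def nrep_cat_def)
  show "Ident ?C V = Ident ?P (part V)" by simp
  show "Comp ?C V W Z = Comp ?P (part V) (part W) (part Z)" for Z
    by simp
next
  fix p :: "nat \<Rightarrow> ('v, 'a, 'k, 'u) rep" and \<tau>
  assume p: "p \<in> Obj ?P"
    and \<tau>: "\<And>\<alpha>. \<alpha> \<in> link_indices n Q \<Longrightarrow>
      \<tau> \<alpha> \<in> Hom ?M (omap (link_source Q \<alpha>) p) (omap (link_target Q \<alpha>) p)"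
  let ?V = "\<lparr> part = p, link = (\<lambda>m\<in>{1..n-1}. \<lambda>\<gamma>\<in>arcs (Q m). \<lambda>\<delta>\<in>arcs (Q (m+1)). \<tau> (m, \<gamma>, \<delta>)) \<rparr>"
  show "\<exists>V\<in>Obj ?C. part V = p \<and> (\<forall>\<alpha>\<in>link_indices n Q. ?str V \<alpha> = \<tau> \<alpha>)"
  proof (rule bexI[of _ ?V])
    have "\<tau> (m, \<gamma>, \<delta>) \<in> lin_maps k (vsp (p m) (head (Q m) \<gamma>)) (vsp (p (m+1)) (tail (Q (m+1)) \<delta>))"
      if "m \<in> {1..n-1}" "\<gamma> \<in> arcs (Q m)" "\<delta> \<in> arcs (Q (m+1))" for m \<gamma> \<delta>
      using \<tau>[of "(m, \<gamma>, \<delta>)"] that by (simp add: link_indices_def)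
    then show "?V \<in> Obj ?C"
      using p by (auto simp: is_nrep_def PiE_iff prod_cat_simps)
  qed (auto simp: link_indices_def)
qed

theorem proposition4p4:
  fixes k :: "('k, 'r) ring_scheme"
    and n :: nat
    and Q :: "nat \<Rightarrow> ('v, 'a) pre_digraph"
  assumes "universe TYPE('u)"
    and "algebraically_closed k"
    and "small TYPE('u) (carrier k)"
    and "n \<ge> 2"
    and "\<And>m. m \<in> {1..n} \<Longrightarrow> finite_connected_acyclic_quiver (Q m)"
  defines "Rep \<equiv> \<lambda>m. rep_cat k (Q m) :: (('v, 'a, 'k, 'u) rep, 'v \<Rightarrow> 'u \<Rightarrow> 'u) cat"
    and "nRep \<equiv> nrep_cat k n Q :: (('v, 'a, 'k, 'u) nrep, nat \<Rightarrow> 'v \<Rightarrow> 'u \<Rightarrow> 'u) cat"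
  shows "cocomplete TYPE('u) nRep \<and>
    cocontinuous TYPE('u) nRep (prod_cat {1..n} Rep) forget \<and>
    (\<forall>(D :: ('u, 'u) cat) F C \<zeta>.
      small_category D \<and> is_functor D nRep F \<and>
      (\<forall>m\<in>{1..n}. is_colimit D (Rep m)
         (fct_comp (proj_fct m) (fct_comp forget F)) (C m) (\<zeta> m)) \<longrightarrow>
      (\<exists>\<psi>'. is_nrep k n Q \<lparr> part = restrict C {1..n}, link = \<psi>' \<rparr> \<and>
         is_colimit D nRep F \<lparr> part = restrict C {1..n}, link = \<psi>' \<rparr> (\<lambda>d. \<lambda>m\<in>{1..n}. \<zeta> m d)))"
proof -
  note univ = assms(1)
  have k: "cring k"
    using assms(2) by (simp add: algebraically_closed_def field_def domain_def)
  have Q: "wf_digraph (Q m)" if "m \<in> {1..n}" for m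
    using assms(5)[OF that] unfolding finite_connected_acyclic_quiver_def
    by (simp add: fin_digraph_def)
  interpret inserter nRep "prod_cat {1..n} Rep" "mod_cat k" "link_indices n Q"
    "link_source Q" "link_target Q" part "\<lambda>V (m, \<gamma>, \<delta>). link V m \<gamma> \<delta>"
    unfolding Rep_def nRep_def using Q by (rule nrep_cat_inserter)
  have U: "U = forget" by (simp add: U_def forget_def)
  note forget = U_functor[unfolded U]
  have Rep_category: "is_category (Rep m)" if "m \<in> {1..n}" for m
    unfolding Rep_def by (rule rep_cat_category[OF Q[OF that]])
  have construction: "is_colimit D (prod_cat {1..n} Rep) (fct_comp forget F) (restrict C {1..n})
        (\<lambda>d. \<lambda>m\<in>{1..n}. \<zeta> m d) \<and>
      (\<exists>\<psi>'. is_nrep k n Q \<lparr> part = restrict C {1..n}, link = \<psi>' \<rparr> \<and>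
        is_colimit D nRep F \<lparr> part = restrict C {1..n}, link = \<psi>' \<rparr> (\<lambda>d. \<lambda>m\<in>{1..n}. \<zeta> m d))"
    if D: "small_category D" and F: "is_functor D nRep F"
      and colim: "\<And>m. m \<in> {1..n} \<Longrightarrow> is_colimit D (Rep m)
        (fct_comp (proj_fct m) (fct_comp forget F)) (C m) (\<zeta> m)"
    for D :: "('u, 'u) cat" and F C \<zeta>
  proof
    note UF = functor_fct_comp[OF F forget]
    show prod: "is_colimit D (prod_cat {1..n} Rep) (fct_comp forget F) (restrict C {1..n})
        (\<lambda>d. \<lambda>m\<in>{1..n}. \<zeta> m d)"
      by (rule colimit_prod_cat[OF UF colim])
    \<comment> \<open>The domains of the links are modules of the given colimits \<open>C m\<close>, and evaluation at a vertex
      preserves those.\<close>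
    have pres: "is_colimit D (mod_cat k) (fct_comp (link_source Q \<alpha>) (fct_comp forget F))
        (omap (link_source Q \<alpha>) (restrict C {1..n}))
        (\<lambda>d. mmap (link_source Q \<alpha>) (part (omap F d)) (restrict C {1..n}) (\<lambda>m\<in>{1..n}. \<zeta> m d))"
      if \<alpha>: "\<alpha> \<in> link_indices n Q" for \<alpha>
    proof -
      obtain m \<gamma> \<delta> where \<alpha>_eq: "\<alpha> = (m, \<gamma>, \<delta>)" by (cases \<alpha>)
      have m: "m \<in> {1..n}" and \<gamma>: "\<gamma> \<in> arcs (Q m)"
        using \<alpha> unfolding \<alpha>_eq link_indices_def by auto
      have "is_colimit D (mod_cat k)
          (fct_comp (eval_fct (head (Q m) \<gamma>)) (fct_comp (proj_fct m) (fct_comp forget F)))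
          (vsp (C m) (head (Q m) \<gamma>)) (\<lambda>d. \<zeta> m d (head (Q m) \<gamma>))"
        using eval_preserves_colimit[OF univ k Q[OF m] D]
          functor_fct_comp[OF UF proj_functor[OF Rep_category m]] colim[OF m]
          wf_digraph.head_in_verts[OF Q[OF m] \<gamma>]
        unfolding Rep_def by blast
      then show ?thesis
        using m by (simp add: \<alpha>_eq) (simp add: link_source_def fct_comp_assoc)
    qed
    obtain V where V: "V \<in> Obj nRep" and part: "part V = restrict C {1..n}"
      and V_colim: "is_colimit D nRep F V (\<lambda>d. \<lambda>m\<in>{1..n}. \<zeta> m d)"
      using colimit_lifts[OF F, unfolded U, OF prod pres] by blast
    have "V = \<lparr> part = restrict C {1..n}, link = link V \<rparr>" using part by simp
    then show "\<exists>\<psi>'. is_nrep k n Q \<lparr> part = restrict C {1..n}, link = \<psi>' \<rparr> \<and>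
        is_colimit D nRep F \<lparr> part = restrict C {1..n}, link = \<psi>' \<rparr> (\<lambda>d. \<lambda>m\<in>{1..n}. \<zeta> m d)"
      using V V_colim unfolding nRep_def nrep_cat_simps by metis
  qed
  have existence: "\<exists>L \<zeta>. is_colimit D nRep F L \<zeta> \<and>
      is_colimit D (prod_cat {1..n} Rep) (fct_comp forget F) (part L) \<zeta>"
    if D: "small_category D" and F: "is_functor D nRep F" for D :: "('u, 'u) cat" and F
  proof -
    have "\<exists>C \<zeta>. is_colimit D (Rep m) (fct_comp (proj_fct m) (fct_comp forget F)) C \<zeta>"
      if m: "m \<in> {1..n}" for m
      using rep_cat_cocomplete[OF univ k Q[OF m]] D
        functor_fct_comp[OF functor_fct_comp[OF F forget] proj_functor[OF Rep_category m]]
      unfolding cocomplete_def Rep_def by blast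
    then obtain C \<zeta> where "\<And>m. m \<in> {1..n} \<Longrightarrow> is_colimit D (Rep m)
        (fct_comp (proj_fct m) (fct_comp forget F)) (C m) (\<zeta> m)"
      by metis
    from construction[OF D F this] show ?thesis
      by (metis nrep.select_convs(1))
  qed
  have "cocontinuous TYPE('u) nRep (prod_cat {1..n} Rep) forget"
    unfolding cocontinuous_def
  proof (intro conjI allI impI forget)
    fix D :: "('u, 'u) cat" and F L \<zeta>
    assume "small_category D \<and> is_functor D nRep F \<and> is_colimit D nRep F L \<zeta>"
    then have D: "small_category D" and F: "is_functor D nRep F"
      and L: "is_colimit D nRep F L \<zeta>" by auto
    obtain L' \<zeta>' where "is_colimit D nRep F L' \<zeta>'"
      and "is_colimit D (prod_cat {1..n} Rep) (fct_comp forget F) (part L') \<zeta>'"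
      using existence[OF D F] by blast
    then show "is_colimit D (prod_cat {1..n} Rep) (fct_comp forget F) (omap forget L)
        (\<lambda>a. mmap forget (omap F a) L (\<zeta> a))"
      by (intro preserves_colimit_if_preserves_one[OF forget F _ _ L]) (simp_all add: forget_def)
  qed
  moreover have "cocomplete TYPE('u) nRep"
    unfolding cocomplete_def using category existence by blast
  ultimately show ?thesis using construction by simp
qed

end
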